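(* Every planar semimodular lattice $L$ can be obtained from the direct product of two finite chains in three steps. That is, there exist finite chains $C$ and $E$ such that, up to isomorphism, $L$ arises as follows. (1) Remove a left corner and a right corner (each possibly empty) from $C\times E$, so as to obtain a planar distributive lattice $D$. (2) Apply a cover-preserving join-homomorphism $\varphi$ to $D$, obtaining the lattice $D\varphi$ (the image of $\varphi$), which is a planar lattice. (3) Add doubly irreducible elements to the interiors of $4$-cells (of a planar diagram) of $D\varphi$, obtaining $L$.
   Context: A planar lattice is a finite lattice that has a planar diagram (Hasse diagram drawn in the plane without crossing edges). A lattice is semimodular if $a\prec b$ implies $a\vee c\preceq b\vee c$ for all $c$; here $\prec$ is the covering relation and $x\preceq y$ means $x\prec y$ or $x=y$. An element is doubly irreducible if it has exactly one lower cover and exactly one upper cover. Corners. Let $A=C\times E$ for finite chains $C$, $E$ with bounds $0_C,1_C,0_E,1_E$, drawn so that its left boundary chain is $\{\langle c,0_E\rangle : c\in C\}\cup\{\langle 1_C,e\rangle : e\in E\}$. Put $A_1=A-\{\langle 1_C,0_E\rangle\}$, with the diagram inherited from $A$, and let $L_1$ be its left boundary chain. Having defined $A_{n-1}$ with left boundary chain $L_{n-1}$, pick a doubly irreducible element $a$ of $A_{n-1}$ lying on $L_{n-1}$, and put $A_n=A_{n-1}-\{a\}$, with left boundary chain $L_n$. A left corner of $A$ is a set of the form $A-A_n$ for some $n$ and some such sequence of choices. Right corners are defined symmetrically, with the right boundary chain and first element $\langle 0_C,1_E\rangle$. The empty set is also allowed as a corner in step (1). Removing corners means passing to the complement with the induced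 order. A join-homomorphism $\varphi\colon D\to K$ of finite lattices is cover-preserving if it preserves $\preceq$, i.e. $x\prec y$ and $x\varphi\ne y\varphi$ imply $x\varphi\prec y\varphi$. Maps are written on the right. A $4$-cell of a planar diagram is a set $\{o,a,b,i\}$ with $o\prec a\prec i$, $o\prec b\prec i$, $a$ to the left of $b$, and no elements inside the region bounded by the chains $\{o,a,i\}$ and $\{o,b,i\}$. Adding doubly irreducible elements to the interior of this $4$-cell means adding finitely many (possibly zero) new elements $x$, pairwise incomparable, each having $o$ as its only lower cover and $i$ as its only upper cover (so the cell becomes a covering $M_n$). *)

theory Defs
  imports "HOL-Analysis.Analysis" "HOL-Algebra.Lattice"
begin

section \<open>Finite lattices\<close>

text \<open>The locale \<^locale>\<open>lattice\<close> admits the empty carrier, which lattices here do not.\<close>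

definition finite_lattice :: "'a gorder \<Rightarrow> bool" where
  "finite_lattice P \<longleftrightarrow> lattice P \<and> finite (carrier P) \<and> carrier P \<noteq> {}"

definition distributive :: "'a gorder \<Rightarrow> bool" where
  "distributive P \<longleftrightarrow> (\<forall>x\<in>carrier P. \<forall>y\<in>carrier P. \<forall>z\<in>carrier P.
     x \<sqinter>\<^bsub>P\<^esub> (y \<squnion>\<^bsub>P\<^esub> z) = (x \<sqinter>\<^bsub>P\<^esub> y) \<squnion>\<^bsub>P\<^esub> (x \<sqinter>\<^bsub>P\<^esub> z))"

definition covers :: "'a gorder \<Rightarrow> 'a \<Rightarrow> 'a \<Rightarrow> bool" where
  "covers P x y \<longleftrightarrow> x \<in> carrier P \<and> y \<in> carrier P \<and> x \<sqsubset>\<^bsub>P\<^esub> y \<and>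
     \<not> (\<exists>z\<in>carrier P. x \<sqsubset>\<^bsub>P\<^esub> z \<and> z \<sqsubset>\<^bsub>P\<^esub> y)"

definition covers_eq :: "'a gorder \<Rightarrow> 'a \<Rightarrow> 'a \<Rightarrow> bool" where
  "covers_eq P x y \<longleftrightarrow> covers P x y \<or> x = y"

definition doubly_irreducible :: "'a gorder \<Rightarrow> 'a \<Rightarrow> bool" where
  "doubly_irreducible P x \<longleftrightarrow> (\<exists>!y. covers P y x) \<and> (\<exists>!y. covers P x y)"

definition semimodular :: "'a gorder \<Rightarrow> bool" where
  "semimodular P \<longleftrightarrow> (\<forall>a\<in>carrier P. \<forall>b\<in>carrier P. \<forall>c\<in>carrier P.
     covers P a b \<longrightarrow> covers_eq P (a \<squnion>\<^bsub>P\<^esub> c) (b \<squnion>\<^bsub>P\<^esub> c))"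

definition cover_preserving_join_hom :: "'a gorder \<Rightarrow> 'b gorder \<Rightarrow> ('a \<Rightarrow> 'b) \<Rightarrow> bool" where
  "cover_preserving_join_hom P Q f \<longleftrightarrow> f \<in> carrier P \<rightarrow> carrier Q \<and> join_pres P Q f \<and>
     (\<forall>x y. covers P x y \<and> f x \<noteq> f y \<longrightarrow> covers Q (f x) (f y))"

definition order_isomorphic :: "'a gorder \<Rightarrow> 'b gorder \<Rightarrow> bool" where
  "order_isomorphic P Q \<longleftrightarrow> (\<exists>f. order_emb P Q f \<and> bij_betw f (carrier P) (carrier Q))"

section \<open>Planar diagrams\<close>

text \<open>Edges are straight line segments, and the second coordinate points upwards.\<close>

definition planar_diagram :: "'a gorder \<Rightarrow> ('a \<Rightarrow> real \<times> real) \<Rightarrow> bool" where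
  "planar_diagram P pos \<longleftrightarrow>
     inj_on pos (carrier P) \<and>
     (\<forall>x\<in>carrier P. \<forall>y\<in>carrier P. x \<sqsubset>\<^bsub>P\<^esub> y \<longrightarrow> snd (pos x) < snd (pos y)) \<and>
     (\<forall>x y z. covers P x y \<and> z \<in> carrier P \<and> pos z \<in> closed_segment (pos x) (pos y)
        \<longrightarrow> z \<in> {x, y}) \<and>
     (\<forall>x y u v. covers P x y \<and> covers P u v \<and> (x, y) \<noteq> (u, v)
        \<longrightarrow> closed_segment (pos x) (pos y) \<inter> closed_segment (pos u) (pos v)
            \<subseteq> pos ` ({x, y} \<inter> {u, v}))"

definition planar_lattice :: "'a gorder \<Rightarrow> bool" where
  "planar_lattice P \<longleftrightarrow> finite_lattice P \<and> (\<exists>pos. planar_diagram P pos)"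

definition drawing :: "'a gorder \<Rightarrow> ('a \<Rightarrow> real \<times> real) \<Rightarrow> (real \<times> real) set" where
  "drawing P pos = pos ` carrier P \<union> (\<Union>(x, y) \<in> {(x, y). covers P x y}. closed_segment (pos x) (pos y))"

definition left_of :: "(real \<times> real) set \<Rightarrow> (real \<times> real) set \<Rightarrow> bool" where
  "left_of S T \<longleftrightarrow> (\<forall>p\<in>S. \<forall>q\<in>T. snd p = snd q \<longrightarrow> fst p \<le> fst q)"

definition left_boundary :: "'a gorder \<Rightarrow> ('a \<Rightarrow> real \<times> real) \<Rightarrow> 'a set" where
  "left_boundary P pos = {x \<in> carrier P. left_of {pos x} (drawing P pos)}"

definition right_boundary :: "'a gorder \<Rightarrow> ('a \<Rightarrow> real \<times> real) \<Rightarrow> 'a set" where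
  "right_boundary P pos = {x \<in> carrier P. left_of (drawing P pos) {pos x}}"

definition chain_path :: "('a \<Rightarrow> real \<times> real) \<Rightarrow> 'a \<Rightarrow> 'a \<Rightarrow> 'a \<Rightarrow> (real \<times> real) set" where
  "chain_path pos x y z = closed_segment (pos x) (pos y) \<union> closed_segment (pos y) (pos z)"

definition four_cell :: "'a gorder \<Rightarrow> ('a \<Rightarrow> real \<times> real) \<Rightarrow> 'a \<times> 'a \<times> 'a \<times> 'a \<Rightarrow> bool" where
  "four_cell P pos = (\<lambda>(u, a, b, v).
     covers P u a \<and> covers P a v \<and> covers P u b \<and> covers P b v \<and>
     a \<noteq> b \<and> left_of (chain_path pos u a v) (chain_path pos u b v) \<and>
     (\<forall>x\<in>carrier P. pos x \<notin> inside (chain_path pos u a v \<union> chain_path pos u b v)))"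

text \<open>
  \<open>adds_to_four_cells P pos Q\<close>: \<open>Q\<close> arises from \<open>P\<close> by adding doubly irreducible elements to the
  interiors of 4-cells of the diagram \<open>pos\<close>; \<open>q x\<close> is the 4-cell that receives the new element \<open>x\<close>.
\<close>

definition adds_to_four_cells ::
    "'a gorder \<Rightarrow> ('a \<Rightarrow> real \<times> real) \<Rightarrow> 'a gorder \<Rightarrow> bool" where
  "adds_to_four_cells P pos Q \<longleftrightarrow>
     partial_order Q \<and> carrier P \<subseteq> carrier Q \<and> finite (carrier Q - carrier P) \<and>
     (\<forall>x\<in>carrier P. \<forall>y\<in>carrier P. x \<sqsubseteq>\<^bsub>Q\<^esub> y \<longleftrightarrow> x \<sqsubseteq>\<^bsub>P\<^esub> y) \<and>
     (\<exists>q. (\<forall>x\<in>carrier Q - carrier P. four_cell P pos (q x) \<and>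
             (case q x of (u, a, b, v) \<Rightarrow> {y. covers Q y x} = {u} \<and> {y. covers Q x y} = {v})) \<and>
          (\<forall>x\<in>carrier Q - carrier P. \<forall>y\<in>carrier Q - carrier P.
             q x = q y \<and> x \<noteq> y \<longrightarrow> \<not> x \<sqsubseteq>\<^bsub>Q\<^esub> y))"

section \<open>Corners of the direct product of two finite chains\<close>

text \<open>
  Up to isomorphism, the finite chains are the sets \<open>{0..m}\<close> of natural numbers.  The product is
  drawn on a grid rotated by 45 degrees, the first factor going up to the left.
\<close>

definition grid :: "nat \<Rightarrow> nat \<Rightarrow> (nat \<times> nat) gorder" where
  "grid m n = \<lparr>carrier = {0..m} \<times> {0..n}, eq = (=),
               le = (\<lambda>(c, e) (c', e'). c \<le> c' \<and> e \<le> e')\<rparr>"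

definition grid_pos :: "nat \<times> nat \<Rightarrow> real \<times> real" where
  "grid_pos = (\<lambda>(c, e). (real e - real c, real e + real c))"

definition restrict_to :: "'a gorder \<Rightarrow> 'a set \<Rightarrow> 'a gorder" where
  "restrict_to P S = P\<lparr>carrier := S\<rparr>"

text \<open>
  The trimmed subsets keep the positions of the grid, so their boundaries are read off the inherited
  drawing.  The first element removed is the left (right) extreme point of the grid.
\<close>

inductive left_trimmed :: "nat \<Rightarrow> nat \<Rightarrow> (nat \<times> nat) set \<Rightarrow> bool" for m n where
  first: "left_trimmed m n (carrier (grid m n) - {(m, 0)})"
| step: "left_trimmed m n S \<Longrightarrow> doubly_irreducible (restrict_to (grid m n) S) a \<Longrightarrow>
         a \<in> left_boundary (restrict_to (grid m n) S) grid_pos \<Longrightarrow>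
         left_trimmed m n (S - {a})"

inductive right_trimmed :: "nat \<Rightarrow> nat \<Rightarrow> (nat \<times> nat) set \<Rightarrow> bool" for m n where
  first: "right_trimmed m n (carrier (grid m n) - {(0, n)})"
| step: "right_trimmed m n S \<Longrightarrow> doubly_irreducible (restrict_to (grid m n) S) a \<Longrightarrow>
         a \<in> right_boundary (restrict_to (grid m n) S) grid_pos \<Longrightarrow>
         right_trimmed m n (S - {a})"

definition left_corner :: "nat \<Rightarrow> nat \<Rightarrow> (nat \<times> nat) set \<Rightarrow> bool" where
  "left_corner m n X \<longleftrightarrow> (\<exists>S. left_trimmed m n S \<and> X = carrier (grid m n) - S)"

definition right_corner :: "nat \<Rightarrow> nat \<Rightarrow> (nat \<times> nat) set \<Rightarrow> bool" where
  "right_corner m n X \<longleftrightarrow> (\<exists>S. right_trimmed m n S \<and> X = carrier (grid m n) - S)"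

lemma grid_covers:
  "covers (grid m n) (c, e) (c', e') \<longleftrightarrow>
     c' \<le> m \<and> e' \<le> n \<and> (c' = Suc c \<and> e' = e \<or> c' = c \<and> e' = Suc e)"
proof
  assume a: "covers (grid m n) (c, e) (c', e')"
  then have le: "c \<le> c'" "e \<le> e'" "c' \<le> m" "e' \<le> n" "c = c' \<Longrightarrow> e \<noteq> e'"
    by (auto simp: covers_def grid_def lless_def)
  have no: "(x, y) = (c, e) \<or> (x, y) = (c', e')"
    if "c \<le> x" "e \<le> y" "x \<le> c'" "y \<le> e'" for x y
  proof (rule ccontr)
    assume "\<not> ?thesis"
    with that le have "(x, y) \<in> carrier (grid m n)" "(c, e) \<sqsubset>\<^bsub>grid m n\<^esub> (x, y)"
        "(x, y) \<sqsubset>\<^bsub>grid m n\<^esub> (c', e')"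
      by (auto simp: grid_def lless_def)
    with a show False by (auto simp: covers_def)
  qed
  show "c' \<le> m \<and> e' \<le> n \<and> (c' = Suc c \<and> e' = e \<or> c' = c \<and> e' = Suc e)"
  proof (cases "c < c'")
    case True
    with no[of "Suc c" e] le show ?thesis by auto
  next
    case False
    with no[of c "Suc e"] le show ?thesis by auto
  qed
next
  assume "c' \<le> m \<and> e' \<le> n \<and> (c' = Suc c \<and> e' = e \<or> c' = c \<and> e' = Suc e)"
  then show "covers (grid m n) (c, e) (c', e')"
    by (auto simp: covers_def grid_def lless_def)
qed

lemma grid_segment:
  "p \<in> closed_segment (grid_pos (c, e)) (grid_pos (c', e')) \<longleftrightarrow>
     (\<exists>t. 0 \<le> t \<and> t \<le> 1 \<and>
        snd p - fst p = 2 * (real c + t * (real c' - real c)) \<and>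
        snd p + fst p = 2 * (real e + t * (real e' - real e)))"
proof -
  obtain a b where p: "p = (a, b)" by (cases p)
  have "p = (1 - t) *\<^sub>R grid_pos (c, e) + t *\<^sub>R grid_pos (c', e') \<longleftrightarrow>
      snd p - fst p = 2 * (real c + t * (real c' - real c)) \<and>
      snd p + fst p = 2 * (real e + t * (real e' - real e))" for t
    unfolding p grid_pos_def by (auto simp: algebra_simps)
  then show ?thesis unfolding closed_segment_def by auto
qed

lemma unit_step_cases:
  assumes "real i + t = real j + s" "0 \<le> t" "t \<le> 1" "0 \<le> s" "s \<le> 1"
  shows "i = j \<and> t = s \<or> i = Suc j \<and> t = 0 \<and> s = 1 \<or> j = Suc i \<and> t = 1 \<and> s = 0"
proof -
  have "i = j \<or> i = Suc j \<or> j = Suc i" using assms by linarith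
  then show ?thesis using assms by auto
qed

lemma planar_diagram_grid: "planar_diagram (grid m n) grid_pos"
proof -
  have inj: "inj_on grid_pos (carrier (grid m n))"
    by (auto simp: inj_on_def grid_pos_def)
  have mono: "\<forall>x\<in>carrier (grid m n). \<forall>y\<in>carrier (grid m n).
      x \<sqsubset>\<^bsub>grid m n\<^esub> y \<longrightarrow> snd (grid_pos x) < snd (grid_pos y)"
    by (auto simp: grid_def lless_def grid_pos_def)
  have step: "closed_segment (grid_pos x) (grid_pos y) \<inter> closed_segment (grid_pos u) (grid_pos v)
            \<subseteq> grid_pos ` ({x, y} \<inter> {u, v})"
    if cov: "covers (grid m n) x y" "covers (grid m n) u v" and ne: "(x, y) \<noteq> (u, v)" for x y u v
  proof
    fix p
    assume p: "p \<in> closed_segment (grid_pos x) (grid_pos y) \<inter> closed_segment (grid_pos u) (grid_pos v)"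
    obtain c e c' e' f g f' g' where xy: "x = (c, e)" "y = (c', e')" "u = (f, g)" "v = (f', g')"
      by (metis surj_pair)
    from p obtain t s where ts: "0 \<le> t" "t \<le> 1" "0 \<le> s" "s \<le> 1"
      and t: "snd p - fst p = 2 * (real c + t * (real c' - real c))"
             "snd p + fst p = 2 * (real e + t * (real e' - real e))"
      and s: "snd p - fst p = 2 * (real f + s * (real f' - real f))"
             "snd p + fst p = 2 * (real g + s * (real g' - real g))"
      unfolding xy by (auto simp: grid_segment)
    have t': "(c' = Suc c \<and> e' = e) \<or> (c' = c \<and> e' = Suc e)"
      and s': "(f' = Suc f \<and> g' = g) \<or> (f' = f \<and> g' = Suc g)"
      using cov unfolding xy grid_covers by auto
    have eq: "real c + t * (real c' - real c) = real f + s * (real f' - real f)"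
             "real e + t * (real e' - real e) = real g + s * (real g' - real g)"
      using t s by auto
    from t' s' consider
        (1) "c' = Suc c" "e' = e" "f' = Suc f" "g' = g"
      | (2) "c' = Suc c" "e' = e" "f' = f" "g' = Suc g"
      | (3) "c' = c" "e' = Suc e" "f' = Suc f" "g' = g"
      | (4) "c' = c" "e' = Suc e" "f' = f" "g' = Suc g" by blast
    then show "p \<in> grid_pos ` ({x, y} \<inter> {u, v})"
    proof cases
      case 1
      with eq have "real c + t = real f + s" "e = g" by auto
      with unit_step_cases[OF this(1) ts] 1 ne t xy show ?thesis
        by (auto simp: prod_eq_iff[of p] grid_pos_def)
    next
      case 2
      with eq have "real c + t = real f + 0" "real e + 0 = real g + s" by auto
      with unit_step_cases[OF this(1)] unit_step_cases[OF this(2)] ts 2 t xy show ?thesis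
        by (auto simp: prod_eq_iff[of p] grid_pos_def)
    next
      case 3
      with eq have "real c + 0 = real f + s" "real e + t = real g + 0" by auto
      with unit_step_cases[OF this(1)] unit_step_cases[OF this(2)] ts 3 t xy show ?thesis
        by (auto simp: prod_eq_iff[of p] grid_pos_def)
    next
      case 4
      with eq have "real e + t = real g + s" "c = f" by auto
      with unit_step_cases[OF this(1) ts] 4 ne t xy show ?thesis
        by (auto simp: prod_eq_iff[of p] grid_pos_def)
    qed
  qed
  have vert: "z \<in> {x, y}"
    if cov: "covers (grid m n) x y" and z: "z \<in> carrier (grid m n)"
      "grid_pos z \<in> closed_segment (grid_pos x) (grid_pos y)" for x y z
  proof -
    obtain c e c' e' k l where xy: "x = (c, e)" "y = (c', e')" "z = (k, l)"
      by (metis surj_pair)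
    from z(2) obtain t where t: "0 \<le> t" "t \<le> 1"
        "real k + 0 = real c + t * (real c' - real c)" "real l + 0 = real e + t * (real e' - real e)"
      unfolding xy by (auto simp: grid_segment) (auto simp: grid_pos_def)
    from cov have "(c' = Suc c \<and> e' = e) \<or> (c' = c \<and> e' = Suc e)"
      unfolding xy grid_covers by auto
    then show ?thesis
      using t unit_step_cases[of k 0 c t] unit_step_cases[of l 0 e t] unfolding xy by auto
  qed
  show ?thesis
    unfolding planar_diagram_def using inj mono vert step by blast
qed

lemma left_boundary_grid:
  "left_boundary (grid m n) grid_pos = {(c, 0) | c. c \<le> m} \<union> {(m, e) | e. e \<le> n}"
proof -
  define H where "H = {p::real \<times> real. (-1, -1) \<bullet> p \<le> 0} \<inter> {p. (-1, 1) \<bullet> p \<le> 2 * real m}"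
  have conv: "convex H"
    unfolding H_def by (intro convex_Int convex_halfspace_le)
  have v: "grid_pos x \<in> H" if "x \<in> carrier (grid m n)" for x
    using that by (auto simp: H_def grid_def grid_pos_def)
  then have "closed_segment (grid_pos x) (grid_pos y) \<subseteq> H" if "covers (grid m n) x y" for x y
    using that conv by (intro closed_segment_subset) (auto simp: covers_def)
  with v have sub: "drawing (grid m n) grid_pos \<subseteq> H" unfolding drawing_def by blast
  have "(c, e) \<in> left_boundary (grid m n) grid_pos \<longleftrightarrow> c \<le> m \<and> e \<le> n \<and> (e = 0 \<or> c = m)" for c e
  proof
    assume a: "(c, e) \<in> left_boundary (grid m n) grid_pos"
    then have b: "c \<le> m" "e \<le> n" by (auto simp: left_boundary_def grid_def)
    have "e = 0 \<or> c = m"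
    proof (rule ccontr)
      assume "\<not> (e = 0 \<or> c = m)"
      with b have "(Suc c, e - 1) \<in> carrier (grid m n)" "0 < e" by (auto simp: grid_def)
      then have "grid_pos (Suc c, e - 1) \<in> drawing (grid m n) grid_pos" "0 < e"
        unfolding drawing_def by blast+
      with a show False by (force simp: left_boundary_def left_of_def grid_pos_def)
    qed
    with b show "c \<le> m \<and> e \<le> n \<and> (e = 0 \<or> c = m)" by simp
  next
    assume "c \<le> m \<and> e \<le> n \<and> (e = 0 \<or> c = m)"
    with sub show "(c, e) \<in> left_boundary (grid m n) grid_pos"
      by (fastforce simp: left_boundary_def left_of_def grid_def grid_pos_def H_def)
  qed
  then show ?thesis by auto
qed

end

(* A planar diagram of a finite lattice provides two linear orders whose intersection is the lattice
   order: besides comparability, two elements may be in the relation "to the left of".  Conversely,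
   drawing an element at its two ranks, rotated by 45 degrees, gives a planar diagram.

   In a planar semimodular lattice L, an upper cover of x that lies strictly between two others is
   doubly irreducible, its only upper cover being the join of the leftmost and the rightmost upper
   cover of x.  Deleting all such elements leaves a sublattice K, from which L is recovered by adding
   doubly irreducible elements to 4-cells.  Each element of K is the join of an element of the left
   and an element of the right boundary chain, and by semimodularity (c, d) |-> c join d is a
   cover-preserving join-homomorphism of the full product of two chains onto K.  Both corners can
   therefore be taken empty. *)
theory Submission
  imports Defs
begin

section \<open>Finite orders and lattices\<close>

text \<open>The given diagram is used once, to compare incomparable elements from left to right.
  From then on an element is a pair of numbers \<open>f\<close>, \<open>g\<close>, and the diagram
  asked for in the conclusion is drawn afresh from them. The obstacle in extracting the pair is that
  the drawing is arbitrary: sides are read off functions of the height, and planarity enters through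
  the intermediate value theorem. Middle covers have to be deleted before the grid is mapped. With a
  single lower cover they are not joins of smaller elements, and they are not on the boundary
  chains, so no join of boundary elements reaches them. The same uniqueness of covers makes the
  remaining elements closed under join and meet. The grid is a square of side
  \<open>card (carrier L)\<close>: a boundary chain reaches the greatest element within that many
  steps and then repeats it. Everything is symmetric under exchanging \<open>f\<close> and
  \<open>g\<close>, so only the left chain is studied.\<close>

lemma (in partial_order) join_eqI:
  assumes "x \<in> carrier L" "y \<in> carrier L" "s \<in> carrier L" "x \<sqsubseteq> s" "y \<sqsubseteq> s"
    and "\<And>z. z \<in> carrier L \<Longrightarrow> x \<sqsubseteq> z \<Longrightarrow> y \<sqsubseteq> z \<Longrightarrow> s \<sqsubseteq> z"
  shows "x \<squnion> y = s"
proof -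
  have "least L s (Upper L {x, y})"
    using assms by (intro least_UpperI) (auto simp: Upper_def)
  then show ?thesis
    unfolding join_def Lattice.sup_def by (meson least_unique someI_ex)
qed

lemma (in partial_order) meet_eqI:
  assumes "x \<in> carrier L" "y \<in> carrier L" "s \<in> carrier L" "s \<sqsubseteq> x" "s \<sqsubseteq> y"
    and "\<And>z. z \<in> carrier L \<Longrightarrow> z \<sqsubseteq> x \<Longrightarrow> z \<sqsubseteq> y \<Longrightarrow> z \<sqsubseteq> s"
  shows "x \<sqinter> y = s"
proof -
  have "greatest L s (Lower L {x, y})"
    using assms by (intro greatest_LowerI) (auto simp: Lower_def)
  then show ?thesis
    unfolding meet_def Lattice.inf_def by (meson greatest_unique someI_ex)
qed

lemma (in partial_order) latticeI:
  assumes "\<And>x y. x \<in> carrier L \<Longrightarrow> y \<in> carrier L \<Longrightarrow> \<exists>s\<in>carrier L. x \<sqsubseteq> s \<and> y \<sqsubseteq> s \<and>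
      (\<forall>z\<in>carrier L. x \<sqsubseteq> z \<longrightarrow> y \<sqsubseteq> z \<longrightarrow> s \<sqsubseteq> z)"
    and "\<And>x y. x \<in> carrier L \<Longrightarrow> y \<in> carrier L \<Longrightarrow> \<exists>s\<in>carrier L. s \<sqsubseteq> x \<and> s \<sqsubseteq> y \<and>
      (\<forall>z\<in>carrier L. z \<sqsubseteq> x \<longrightarrow> z \<sqsubseteq> y \<longrightarrow> z \<sqsubseteq> s)"
  shows "lattice L"
proof unfold_locales
  fix x y assume xy: "x \<in> carrier L" "y \<in> carrier L"
  obtain s where "s \<in> carrier L" "x \<sqsubseteq> s" "y \<sqsubseteq> s"
      "\<forall>z\<in>carrier L. x \<sqsubseteq> z \<longrightarrow> y \<sqsubseteq> z \<longrightarrow> s \<sqsubseteq> z"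
    using assms(1)[OF xy] by blast
  then have "least L s (Upper L {x, y})"
    using xy by (intro least_UpperI) (auto simp: Upper_def)
  then show "\<exists>s. least L s (Upper L {x, y})" ..
  obtain t where "t \<in> carrier L" "t \<sqsubseteq> x" "t \<sqsubseteq> y"
      "\<forall>z\<in>carrier L. z \<sqsubseteq> x \<longrightarrow> z \<sqsubseteq> y \<longrightarrow> z \<sqsubseteq> t"
    using assms(2)[OF xy] by blast
  then have "greatest L t (Lower L {x, y})"
    using xy by (intro greatest_LowerI) (auto simp: Lower_def)
  then show "\<exists>s. greatest L s (Lower L {x, y})" ..
qed

text \<open>Serves twice: for a subset of \<open>L\<close> with the identity map, and for a copy of
  \<open>L\<close> on another type. The second conclusion is needed because the join of
  \<open>Q\<close> is computed from the order of \<open>Q\<close> alone.\<close>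

lemma lattice_embedded:
  assumes L: "lattice L" and Q: "partial_order Q" and f: "f \<in> carrier Q \<rightarrow> carrier L"
    and emb: "\<And>x y. x \<in> carrier Q \<Longrightarrow> y \<in> carrier Q \<Longrightarrow> f x \<sqsubseteq>\<^bsub>L\<^esub> f y \<longleftrightarrow> x \<sqsubseteq>\<^bsub>Q\<^esub> y"
    and join: "\<And>x y. x \<in> carrier Q \<Longrightarrow> y \<in> carrier Q \<Longrightarrow> f x \<squnion>\<^bsub>L\<^esub> f y \<in> f ` carrier Q"
    and meet: "\<And>x y. x \<in> carrier Q \<Longrightarrow> y \<in> carrier Q \<Longrightarrow> f x \<sqinter>\<^bsub>L\<^esub> f y \<in> f ` carrier Q"
  shows "lattice Q"
    and "\<And>x y. x \<in> carrier Q \<Longrightarrow> y \<in> carrier Q \<Longrightarrow> f (x \<squnion>\<^bsub>Q\<^esub> y) = f x \<squnion>\<^bsub>L\<^esub> f y"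
proof -
  interpret L: lattice L by (fact L)
  interpret Q: partial_order Q by (fact Q)
  have fc: "f x \<in> carrier L" if "x \<in> carrier Q" for x using f that by auto
  have sup: "\<exists>s\<in>carrier Q. f s = f x \<squnion>\<^bsub>L\<^esub> f y \<and> x \<sqsubseteq>\<^bsub>Q\<^esub> s \<and> y \<sqsubseteq>\<^bsub>Q\<^esub> s \<and>
      (\<forall>z\<in>carrier Q. x \<sqsubseteq>\<^bsub>Q\<^esub> z \<longrightarrow> y \<sqsubseteq>\<^bsub>Q\<^esub> z \<longrightarrow> s \<sqsubseteq>\<^bsub>Q\<^esub> z)"
    if xy: "x \<in> carrier Q" "y \<in> carrier Q" for x y
  proof -
    obtain s where s: "s \<in> carrier Q" "f s = f x \<squnion>\<^bsub>L\<^esub> f y" using join[OF xy] by force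
    have "f x \<sqsubseteq>\<^bsub>L\<^esub> f s" "f y \<sqsubseteq>\<^bsub>L\<^esub> f s"
      using s xy fc by (simp_all add: L.join_left L.join_right)
    moreover have "f s \<sqsubseteq>\<^bsub>L\<^esub> f z" if "z \<in> carrier Q" "x \<sqsubseteq>\<^bsub>Q\<^esub> z" "y \<sqsubseteq>\<^bsub>Q\<^esub> z" for z
      using s(2) xy fc that by (simp add: L.join_le emb)
    ultimately show ?thesis using s xy by (metis emb)
  qed
  have inf: "\<exists>s\<in>carrier Q. s \<sqsubseteq>\<^bsub>Q\<^esub> x \<and> s \<sqsubseteq>\<^bsub>Q\<^esub> y \<and>
      (\<forall>z\<in>carrier Q. z \<sqsubseteq>\<^bsub>Q\<^esub> x \<longrightarrow> z \<sqsubseteq>\<^bsub>Q\<^esub> y \<longrightarrow> z \<sqsubseteq>\<^bsub>Q\<^esub> s)"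
    if xy: "x \<in> carrier Q" "y \<in> carrier Q" for x y
  proof -
    obtain s where s: "s \<in> carrier Q" "f s = f x \<sqinter>\<^bsub>L\<^esub> f y" using meet[OF xy] by force
    have "f s \<sqsubseteq>\<^bsub>L\<^esub> f x" "f s \<sqsubseteq>\<^bsub>L\<^esub> f y"
      using s xy fc by (simp_all add: L.meet_left L.meet_right)
    moreover have "f z \<sqsubseteq>\<^bsub>L\<^esub> f s" if "z \<in> carrier Q" "z \<sqsubseteq>\<^bsub>Q\<^esub> x" "z \<sqsubseteq>\<^bsub>Q\<^esub> y" for z
      using s(2) xy fc that by (simp add: L.meet_le emb)
    ultimately show ?thesis using s xy by (metis emb)
  qed
  show "lattice Q"
    using sup inf by (intro Q.latticeI) blast+
  show "f (x \<squnion>\<^bsub>Q\<^esub> y) = f x \<squnion>\<^bsub>L\<^esub> f y" if xy: "x \<in> carrier Q" "y \<in> carrier Q" for x y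
  proof -
    obtain s where "s \<in> carrier Q" "f s = f x \<squnion>\<^bsub>L\<^esub> f y" "x \<sqsubseteq>\<^bsub>Q\<^esub> s" "y \<sqsubseteq>\<^bsub>Q\<^esub> s"
      "\<forall>z\<in>carrier Q. x \<sqsubseteq>\<^bsub>Q\<^esub> z \<longrightarrow> y \<sqsubseteq>\<^bsub>Q\<^esub> z \<longrightarrow> s \<sqsubseteq>\<^bsub>Q\<^esub> z"
      using sup[OF xy] by blast
    moreover from this have "x \<squnion>\<^bsub>Q\<^esub> y = s" using xy by (intro Q.join_eqI) auto
    ultimately show ?thesis by simp
  qed
qed

lemma partial_order_restrict_to:
  fixes L :: "'a gorder"
  assumes "partial_order L" "S \<subseteq> carrier L"
  shows "partial_order (restrict_to L S)"
proof -
  interpret partial_order L by fact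
  interpret S: weak_partial_order "restrict_to L S"
    unfolding restrict_to_def
    by (rule weak_partial_order_subset[OF weak_partial_order_axioms assms(2)])
  show ?thesis
    by unfold_locales (simp add: restrict_to_def eq_is_equal)
qed

locale finite_order = partial_order L for L :: "'a gorder" (structure) +
  assumes finite_carrier: "finite (carrier L)"
begin

lemma covers_iff:
  "covers L x y \<longleftrightarrow> x \<in> carrier L \<and> y \<in> carrier L \<and> x \<sqsubseteq> y \<and> x \<noteq> y \<and>
     (\<forall>z\<in>carrier L. x \<sqsubseteq> z \<longrightarrow> z \<sqsubseteq> y \<longrightarrow> z = x \<or> z = y)"
  unfolding covers_def lless_eq by blast

text \<open>Among the elements above \<open>x\<close> and up to \<open>y\<close>, one with the
  fewest elements below it is a cover of \<open>x\<close>: anything strictly between would have a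
  smaller down-set.\<close>

lemma cover_above:
  assumes "x \<in> carrier L" "y \<in> carrier L" "x \<sqsubseteq> y" "x \<noteq> y"
  obtains z where "covers L x z" "z \<sqsubseteq> y"
proof -
  let ?P = "\<lambda>z. z \<in> carrier L \<and> x \<sqsubseteq> z \<and> x \<noteq> z \<and> z \<sqsubseteq> y"
  let ?D = "\<lambda>z. {w \<in> carrier L. w \<sqsubseteq> z}"
  obtain z where z: "?P z" and min: "\<And>w. ?P w \<Longrightarrow> card (?D z) \<le> card (?D w)"
    using ex_has_least_nat[of ?P y "\<lambda>z. card (?D z)"] assms by auto
  have "w = x \<or> w = z" if w: "w \<in> carrier L" "x \<sqsubseteq> w" "w \<sqsubseteq> z" for w
  proof (rule ccontr)
    assume neq: "\<not> (w = x \<or> w = z)"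
    have "?P w" using w z neq assms(2) le_trans by blast
    moreover have "?D w \<subset> ?D z" using w z neq le_trans by blast
    ultimately show False
      using min psubset_card_mono[of "?D z" "?D w"] finite_carrier by fastforce
  qed
  with z assms that show thesis by (auto simp: covers_iff)
qed

lemma cover_below:
  assumes "x \<in> carrier L" "y \<in> carrier L" "x \<sqsubseteq> y" "x \<noteq> y"
  obtains z where "covers L z y" "x \<sqsubseteq> z"
proof -
  let ?P = "\<lambda>z. z \<in> carrier L \<and> x \<sqsubseteq> z \<and> y \<noteq> z \<and> z \<sqsubseteq> y"
  let ?D = "\<lambda>z. {w \<in> carrier L. z \<sqsubseteq> w}"
  obtain z where z: "?P z" and min: "\<And>w. ?P w \<Longrightarrow> card (?D z) \<le> card (?D w)"
    using ex_has_least_nat[of ?P x "\<lambda>z. card (?D z)"] assms by auto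
  have "w = y \<or> w = z" if w: "w \<in> carrier L" "z \<sqsubseteq> w" "w \<sqsubseteq> y" for w
  proof (rule ccontr)
    assume neq: "\<not> (w = y \<or> w = z)"
    have "?P w" using w z neq assms(1) le_trans by blast
    moreover have "?D w \<subset> ?D z" using w z neq le_trans by blast
    ultimately show False
      using min psubset_card_mono[of "?D z" "?D w"] finite_carrier by fastforce
  qed
  with z assms that show thesis by (auto simp: covers_iff)
qed

end

lemma (in lattice) finite_bounds:
  assumes "finite (carrier L)" "carrier L \<noteq> {}"
  obtains z u where "z \<in> carrier L" "u \<in> carrier L"
    "\<And>x. x \<in> carrier L \<Longrightarrow> z \<sqsubseteq> x" "\<And>x. x \<in> carrier L \<Longrightarrow> x \<sqsubseteq> u"
proof -
  have l: "least L (\<Squnion>carrier L) (Upper L (carrier L))"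
    using assms by (intro finite_sup_least) auto
  have g: "greatest L (\<Sqinter>carrier L) (Lower L (carrier L))"
    using assms by (intro finite_inf_greatest) auto
  show thesis
    using that[of "\<Sqinter>carrier L" "\<Squnion>carrier L"] l g
      least_Upper_above[OF l] greatest_Lower_below[OF g] by auto
qed

section \<open>Planar diagrams and pairs of linear orders\<close>

text \<open>Order dimension at most two. The linear extensions are given by real values rather than
  as relations, so that they can serve as coordinates.\<close>

definition realizer :: "'a gorder \<Rightarrow> ('a \<Rightarrow> real) \<Rightarrow> ('a \<Rightarrow> real) \<Rightarrow> bool" where
  "realizer P f g \<longleftrightarrow> inj_on f (carrier P) \<and> inj_on g (carrier P) \<and>
     (\<forall>x\<in>carrier P. \<forall>y\<in>carrier P. x \<sqsubseteq>\<^bsub>P\<^esub> y \<longleftrightarrow> f x \<le> f y \<and> g x \<le> g y)"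

text \<open>The number of predecessors is the rank in a finite strict linear order; this turns a
  relation into numerical values.\<close>

lemma card_predecessors_less_iff:
  assumes "finite A" "\<And>x. x \<in> A \<Longrightarrow> \<not> r x x"
    and "\<And>x y z. x \<in> A \<Longrightarrow> y \<in> A \<Longrightarrow> z \<in> A \<Longrightarrow> r x y \<Longrightarrow> r y z \<Longrightarrow> r x z"
    and "\<And>x y. x \<in> A \<Longrightarrow> y \<in> A \<Longrightarrow> x \<noteq> y \<Longrightarrow> r x y \<or> r y x"
    and "x \<in> A" "y \<in> A"
  shows "card {z \<in> A. r z x} < card {z \<in> A. r z y} \<longleftrightarrow> r x y"
proof -
  have mono: "card {z \<in> A. r z a} < card {z \<in> A. r z b}" if "r a b" "a \<in> A" "b \<in> A" for a b
  proof (rule psubset_card_mono)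
    have "{z \<in> A. r z a} \<subseteq> {z \<in> A. r z b}" using assms(3) that by blast
    moreover have "a \<in> {z \<in> A. r z b}" "a \<notin> {z \<in> A. r z a}" using assms(2) that by auto
    ultimately show "{z \<in> A. r z a} \<subset> {z \<in> A. r z b}" by blast
  qed (use assms(1) in simp)
  show ?thesis
    using mono[of x y] mono[of y x] assms(2,4-6) by (metis less_asym)
qed

text \<open>The relation \<open>l\<close> is a conjugate order: it orders exactly the incomparable
  pairs. Adding \<open>l\<close> or its converse makes the order linear, and a pair on which both
  extensions agree cannot be related by \<open>l\<close>, hence is comparable.\<close>

lemma (in finite_order) realizer_of_conjugate:
  assumes incomp: "\<And>x y. x \<in> carrier L \<Longrightarrow> y \<in> carrier L \<Longrightarrow>
        \<not> x \<sqsubseteq> y \<and> \<not> y \<sqsubseteq> x \<longleftrightarrow> l x y \<or> l y x"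
    and asym: "\<And>x y. x \<in> carrier L \<Longrightarrow> y \<in> carrier L \<Longrightarrow> l x y \<Longrightarrow> \<not> l y x"
    and trans: "\<And>x y z. x \<in> carrier L \<Longrightarrow> y \<in> carrier L \<Longrightarrow> z \<in> carrier L \<Longrightarrow>
        l x y \<Longrightarrow> l y z \<Longrightarrow> l x z"
  shows "\<exists>f g. realizer L f g"
proof -
  have lin: "\<exists>f :: 'a \<Rightarrow> real. \<forall>x\<in>carrier L. \<forall>y\<in>carrier L. f x < f y \<longleftrightarrow> x \<sqsubseteq> y \<and> x \<noteq> y \<or> k x y"
    if k: "k = l \<or> k = (\<lambda>x y. l y x)" for k
  proof -
    define r where "r x y \<longleftrightarrow> x \<sqsubseteq> y \<and> x \<noteq> y \<or> k x y" for x y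
    have inc: "\<not> x \<sqsubseteq> y \<and> \<not> y \<sqsubseteq> x \<longleftrightarrow> k x y \<or> k y x" if "x \<in> carrier L" "y \<in> carrier L" for x y
      using incomp that k by blast
    have as: "\<not> k y x" if "x \<in> carrier L" "y \<in> carrier L" "k x y" for x y
      using asym that k by blast
    have tr: "k x z" if "x \<in> carrier L" "y \<in> carrier L" "z \<in> carrier L" "k x y" "k y z" for x y z
      using trans that k by blast
    have irr: "\<not> r x x" if "x \<in> carrier L" for x using that as unfolding r_def by blast
    have tot: "r x y \<or> r y x" if "x \<in> carrier L" "y \<in> carrier L" "x \<noteq> y" for x y
      using that inc unfolding r_def by blast
    have k_inc: "\<not> x \<sqsubseteq> y" "\<not> y \<sqsubseteq> x" if "x \<in> carrier L" "y \<in> carrier L" "k x y" for x y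
      using inc[of x y] that by auto
    have "r x v" if c: "x \<in> carrier L" "y \<in> carrier L" "v \<in> carrier L" and xy: "r x y" and yv: "r y v" for x y v
    proof -
      consider "x \<sqsubseteq> y" "x \<noteq> y" "y \<sqsubseteq> v" "y \<noteq> v" | "x \<sqsubseteq> y" "k y v" | "k x y" "y \<sqsubseteq> v" | "k x y" "k y v"
        using xy yv unfolding r_def by blast
      then show ?thesis
      proof cases
        case 1
        then show ?thesis using le_trans[of x y v] le_antisym[of x y] c unfolding r_def by blast
      next
        case 2
        \<comment> \<open>\<open>v \<sqsubseteq> x\<close> would give
          \<open>v \<sqsubseteq> y\<close>, and \<open>k v x\<close> would give
          \<open>k y x\<close>. Both contradict the case, and totality leaves
          \<open>r x v\<close>.\<close>
        have "\<not> v \<sqsubseteq> x" using 2 k_inc[OF c(2,3)] le_trans[of v x y] c by blast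
        moreover have "\<not> k v x" using 2 k_inc[OF c(2,1)] tr[OF c(2,3,1)] by blast
        moreover from 2 k_inc[OF c(2,3)] have "x \<noteq> v" by blast
        ultimately show ?thesis using inc[OF c(1,3)] unfolding r_def by blast
      next
        case 3
        have "\<not> v \<sqsubseteq> x" using 3 k_inc[OF c(1,2)] le_trans[of y v x] c by blast
        moreover have "\<not> k v x" using 3 k_inc[OF c(3,2)] tr[OF c(3,1,2)] by blast
        moreover from 3 k_inc[OF c(1,2)] have "x \<noteq> v" by blast
        ultimately show ?thesis using inc[OF c(1,3)] unfolding r_def by blast
      next
        case 4
        then show ?thesis using tr[OF c] unfolding r_def by blast
      qed
    qed
    then have "card {w \<in> carrier L. r w x} < card {w \<in> carrier L. r w y} \<longleftrightarrow> r x y"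
      if "x \<in> carrier L" "y \<in> carrier L" for x y
      using finite_carrier irr tot that by (intro card_predecessors_less_iff) blast+
    then show ?thesis
      by (intro exI[of _ "\<lambda>x. real (card {w \<in> carrier L. r w x})"]) (simp add: r_def)
  qed
  obtain f g :: "'a \<Rightarrow> real"
    where f: "\<forall>x\<in>carrier L. \<forall>y\<in>carrier L. f x < f y \<longleftrightarrow> x \<sqsubseteq> y \<and> x \<noteq> y \<or> l x y"
      and g: "\<forall>x\<in>carrier L. \<forall>y\<in>carrier L. g x < g y \<longleftrightarrow> x \<sqsubseteq> y \<and> x \<noteq> y \<or> l y x"
    using lin[of l] lin[of "\<lambda>x y. l y x"] by auto
  have fg: "f x < f y \<longleftrightarrow> x \<sqsubseteq> y \<and> x \<noteq> y \<or> l x y" "g x < g y \<longleftrightarrow> x \<sqsubseteq> y \<and> x \<noteq> y \<or> l y x"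
    if "x \<in> carrier L" "y \<in> carrier L" for x y
    using f g that by auto
  have inj: "x = y" if "x \<in> carrier L" "y \<in> carrier L" "f x = f y \<or> g x = g y" for x y
  proof (rule ccontr)
    assume "x \<noteq> y"
    then show False using that fg[of x y] fg[of y x] incomp[of x y] by auto
  qed
  have "x \<sqsubseteq> y \<longleftrightarrow> f x \<le> f y \<and> g x \<le> g y" if c: "x \<in> carrier L" "y \<in> carrier L" for x y
  proof (cases "x = y")
    case False
    have "\<not> (l x y \<and> l y x)" using asym c by blast
    then show ?thesis
      using False fg[OF c] fg[of y x] c incomp[OF c] le_antisym[of x y]
      by (auto simp: not_less[symmetric])
  qed (use c in auto)
  then have "realizer L f g"
    unfolding realizer_def inj_on_def using inj by blast
  then show ?thesis by blast
qed

section \<open>Sides of a maximal chain in a planar diagram\<close>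

lemma continuous_on_glue:
  fixes f g :: "real \<Rightarrow> real"
  assumes "continuous_on {a..b} f" "continuous_on {b..c} g" "f b = g b" "a \<le> b" "b \<le> c"
  shows "continuous_on {a..c} (\<lambda>t. if t \<le> b then f t else g t)"
proof -
  have "continuous_on ({a..b} \<union> {b..c}) (\<lambda>t. if t \<le> b then f t else g t)"
    using assms by (intro continuous_on_cases) auto
  moreover have "{a..b} \<union> {b..c} = {a..c}" using assms by auto
  ultimately show ?thesis by simp
qed

text \<open>The zero is strictly inside the interval; this strictness later tells whether an edge at
  that height is above one element or below another.\<close>

lemma sign_change_zero:
  fixes f :: "real \<Rightarrow> real"
  assumes "continuous_on {s..t} f" "s \<le> t" "f s * f t < 0"
  obtains r where "s < r" "r < t" "f r = 0"
proof -
  have "\<exists>r. s \<le> r \<and> r \<le> t \<and> f r = 0"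
    using assms IVT'[of f s 0 t] IVT2'[of f t 0 s] by (auto simp: mult_less_0_iff)
  then obtain r where "s \<le> r" "r \<le> t" "f r = 0" by blast
  moreover from this have "r \<noteq> s" "r \<noteq> t" using assms(3) by auto
  ultimately show thesis using that by force
qed

text \<open>
  For a fixed element \<open>y\<close>, the edges of a maximal chain through \<open>y\<close> form the graph of a continuous
  function of the height, and \<open>x\<close> is to the left of \<open>y\<close> when it lies to the left of this graph.  Two
  such graphs that change sides between two heights meet, by planarity, in a common vertex.  This
  makes the choice of the chain immaterial and yields transitivity.
\<close>

locale bounded_planar_diagram = finite_order L for L (structure) +
  fixes pos :: "'a \<Rightarrow> real \<times> real" and z u :: 'a
  assumes z: "z \<in> carrier L" "\<And>x. x \<in> carrier L \<Longrightarrow> z \<sqsubseteq> x"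
    and u: "u \<in> carrier L" "\<And>x. x \<in> carrier L \<Longrightarrow> x \<sqsubseteq> u"
    and planar: "planar_diagram L pos"
begin

abbreviation height :: "'a \<Rightarrow> real" where "height x \<equiv> snd (pos x)"
abbreviation abscissa :: "'a \<Rightarrow> real" where "abscissa x \<equiv> fst (pos x)"
abbreviation edge :: "'a \<Rightarrow> 'a \<Rightarrow> (real \<times> real) set" where
  "edge a b \<equiv> closed_segment (pos a) (pos b)"

lemma height_less: "x \<in> carrier L \<Longrightarrow> y \<in> carrier L \<Longrightarrow> x \<sqsubseteq> y \<Longrightarrow> x \<noteq> y \<Longrightarrow> height x < height y"
  using planar unfolding planar_diagram_def lless_eq by blast

lemma height_le: "x \<in> carrier L \<Longrightarrow> y \<in> carrier L \<Longrightarrow> x \<sqsubseteq> y \<Longrightarrow> height x \<le> height y"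
  using height_less[of x y] by (cases "x = y") auto

lemma vertex_on_edge: "covers L a b \<Longrightarrow> x \<in> carrier L \<Longrightarrow> pos x \<in> edge a b \<Longrightarrow> x = a \<or> x = b"
  using planar unfolding planar_diagram_def by blast

lemma edges_meet:
  assumes "covers L a b" "covers L c d" "p \<in> edge a b" "p \<in> edge c d"
  obtains w where "w \<in> {a, b}" "w \<in> {c, d}"
proof (cases "(a, b) = (c, d)")
  case False
  then have "p \<in> pos ` ({a, b} \<inter> {c, d})"
    using planar assms unfolding planar_diagram_def by blast
  then show thesis using that by blast
qed (use that in auto)

lemma edge_height:
  assumes "covers L a b" "(s, t) \<in> edge a b"
  shows "height a \<le> t" and "t \<le> height b"
proof -
  have le: "height a \<le> height b" using assms(1) height_le by (auto simp: covers_iff)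
  obtain c where c: "0 \<le> c" "c \<le> 1" "t = (1 - c) * height a + c * height b"
    using assms(2) unfolding closed_segment_def by (auto simp: prod_eq_iff)
  have eq: "t - height a = c * (height b - height a)" "height b - t = (1 - c) * (height b - height a)"
    using c by (simp_all add: algebra_simps)
  have "0 \<le> t - height a" "0 \<le> height b - t"
    unfolding eq using c le by simp_all
  then show "height a \<le> t" "t \<le> height b" by simp_all
qed

text \<open>The chain itself is forgotten: the curve only records that at each height it runs on
  some edge of the interval from \<open>a\<close> to \<open>b\<close>.\<close>

definition joined_by :: "'a \<Rightarrow> 'a \<Rightarrow> (real \<Rightarrow> real) \<Rightarrow> bool" where
  "joined_by a b g \<longleftrightarrow> continuous_on {height a..height b} g \<and>
     g (height a) = abscissa a \<and> g (height b) = abscissa b \<and>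
     (\<forall>t\<in>{height a..height b}. \<exists>c d. covers L c d \<and> a \<sqsubseteq> c \<and> d \<sqsubseteq> b \<and> (g t, t) \<in> edge c d)"

lemma joined_byD:
  assumes "joined_by a b g"
  shows "continuous_on {height a..height b} g" "g (height a) = abscissa a" "g (height b) = abscissa b"
    "\<And>t. t \<in> {height a..height b} \<Longrightarrow>
      \<exists>c d. covers L c d \<and> a \<sqsubseteq> c \<and> d \<sqsubseteq> b \<and> (g t, t) \<in> edge c d"
  using assms unfolding joined_by_def by blast+

lemma joined_by_cover:
  assumes ab: "covers L a b"
  shows "\<exists>g. joined_by a b g"
proof -
  define q where "q t = (t - height a) / (height b - height a)" for t
  let ?g = "\<lambda>t. abscissa a + q t * (abscissa b - abscissa a)"
  have car: "a \<in> carrier L" "b \<in> carrier L" "a \<sqsubseteq> b" "a \<noteq> b" using ab unfolding covers_iff by blast+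
  have lt: "height a < height b" using height_less[OF car] .
  have on_edge: "(?g t, t) \<in> edge a b" if "t \<in> {height a..height b}" for t
  proof -
    have "q t * (height b - height a) = t - height a" using lt by (simp add: q_def)
    then have "t = (1 - q t) * height a + q t * height b" by (simp add: algebra_simps)
    then have "(?g t, t) = (1 - q t) *\<^sub>R pos a + q t *\<^sub>R pos b"
      by (simp add: prod_eq_iff algebra_simps)
    moreover have "0 \<le> q t" "q t \<le> 1" using that lt by (simp_all add: q_def)
    ultimately show ?thesis unfolding closed_segment_def by blast
  qed
  have "continuous_on {height a..height b} ?g"
    unfolding q_def by (intro continuous_intros) (use lt in auto)
  moreover have "q (height a) = 0" "q (height b) = 1" using lt by (simp_all add: q_def)
  moreover have "\<exists>c d. covers L c d \<and> a \<sqsubseteq> c \<and> d \<sqsubseteq> b \<and> (?g t, t) \<in> edge c d"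
    if "t \<in> {height a..height b}" for t
    using on_edge[OF that] ab car by (intro exI[of _ a] exI[of _ b] conjI le_refl)
  ultimately have "joined_by a b ?g" unfolding joined_by_def by simp
  then show ?thesis by (rule exI[of _ ?g])
qed

lemma joined_by_trans:
  assumes g: "joined_by a b g" and h: "joined_by b c h"
    and car: "a \<in> carrier L" "b \<in> carrier L" "c \<in> carrier L" and le: "a \<sqsubseteq> b" "b \<sqsubseteq> c"
  shows "joined_by a c (\<lambda>t. if t \<le> height b then g t else h t)"
proof -
  let ?k = "\<lambda>t. if t \<le> height b then g t else h t"
  have ht: "height a \<le> height b" "height b \<le> height c" using height_le car le by blast+
  have "\<exists>e d. covers L e d \<and> a \<sqsubseteq> e \<and> d \<sqsubseteq> c \<and> (?k t, t) \<in> edge e d"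
    if t: "t \<in> {height a..height c}" for t
  proof (cases "t \<le> height b")
    case True
    then obtain e d where ed: "covers L e d" "a \<sqsubseteq> e" "d \<sqsubseteq> b" "(g t, t) \<in> edge e d"
      using joined_byD(4)[OF g, of t] t by auto
    have "d \<in> carrier L" using ed(1) unfolding covers_iff by blast
    then have "d \<sqsubseteq> c" using le_trans[OF ed(3) le(2)] car by blast
    then show ?thesis using True ed by (intro exI[of _ e] exI[of _ d]) simp
  next
    case False
    then obtain e d where ed: "covers L e d" "b \<sqsubseteq> e" "d \<sqsubseteq> c" "(h t, t) \<in> edge e d"
      using joined_byD(4)[OF h, of t] t by auto
    have "e \<in> carrier L" using ed(1) unfolding covers_iff by blast
    then have "a \<sqsubseteq> e" using le_trans[OF le(1) ed(2)] car by blast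
    then show ?thesis using False ed by (intro exI[of _ e] exI[of _ d]) simp
  qed
  moreover have "continuous_on {height a..height c} ?k"
    using joined_byD[OF g] joined_byD[OF h] ht by (intro continuous_on_glue) simp_all
  moreover have "?k (height a) = abscissa a" "?k (height c) = abscissa c"
    using joined_byD(2,3)[OF g] joined_byD(2,3)[OF h] ht by auto
  ultimately show ?thesis unfolding joined_by_def by blast
qed

text \<open>By induction on the size of the interval: a cover is one edge, and otherwise any element
  strictly inside splits it into two smaller intervals, whose curves are glued.\<close>

lemma joined_by_exists:
  assumes "a \<in> carrier L" "b \<in> carrier L" "a \<sqsubseteq> b" "a \<noteq> b"
  shows "\<exists>g. joined_by a b g"
  using assms
proof (induction "card {c \<in> carrier L. a \<sqsubseteq> c \<and> c \<sqsubseteq> b}" arbitrary: a b rule: less_induct)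
  case less
  note ab = less.prems
  show ?case
  proof (cases "covers L a b")
    case True
    then show ?thesis by (rule joined_by_cover)
  next
    case False
    then obtain c where c: "c \<in> carrier L" "a \<sqsubseteq> c" "c \<sqsubseteq> b" "c \<noteq> a" "c \<noteq> b"
      using ab unfolding covers_iff by blast
    have not_le: "\<not> b \<sqsubseteq> c" "\<not> c \<sqsubseteq> a" using c ab le_antisym by blast+
    have "{d \<in> carrier L. a \<sqsubseteq> d \<and> d \<sqsubseteq> c} \<subset> {d \<in> carrier L. a \<sqsubseteq> d \<and> d \<sqsubseteq> b}"
    proof
      show "{d \<in> carrier L. a \<sqsubseteq> d \<and> d \<sqsubseteq> c} \<subseteq> {d \<in> carrier L. a \<sqsubseteq> d \<and> d \<sqsubseteq> b}"
        using le_trans[OF _ c(3)] c ab by blast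
      show "{d \<in> carrier L. a \<sqsubseteq> d \<and> d \<sqsubseteq> c} \<noteq> {d \<in> carrier L. a \<sqsubseteq> d \<and> d \<sqsubseteq> b}"
        using ab not_le(1) le_refl by blast
    qed
    then have card1: "card {d \<in> carrier L. a \<sqsubseteq> d \<and> d \<sqsubseteq> c} < card {d \<in> carrier L. a \<sqsubseteq> d \<and> d \<sqsubseteq> b}"
      using finite_carrier by (intro psubset_card_mono) simp_all
    have "{d \<in> carrier L. c \<sqsubseteq> d \<and> d \<sqsubseteq> b} \<subset> {d \<in> carrier L. a \<sqsubseteq> d \<and> d \<sqsubseteq> b}"
    proof
      show "{d \<in> carrier L. c \<sqsubseteq> d \<and> d \<sqsubseteq> b} \<subseteq> {d \<in> carrier L. a \<sqsubseteq> d \<and> d \<sqsubseteq> b}"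
        using le_trans[OF c(2)] c ab by blast
      show "{d \<in> carrier L. c \<sqsubseteq> d \<and> d \<sqsubseteq> b} \<noteq> {d \<in> carrier L. a \<sqsubseteq> d \<and> d \<sqsubseteq> b}"
        using ab not_le(2) le_refl by blast
    qed
    then have card2: "card {d \<in> carrier L. c \<sqsubseteq> d \<and> d \<sqsubseteq> b} < card {d \<in> carrier L. a \<sqsubseteq> d \<and> d \<sqsubseteq> b}"
      using finite_carrier by (intro psubset_card_mono) simp_all
    obtain g where g: "joined_by a c g"
      using less.hyps[OF card1 ab(1) c(1,2)] c(4) by blast
    obtain h where h: "joined_by c b h"
      using less.hyps[OF card2 c(1) ab(2) c(3,5)] by blast
    show ?thesis using joined_by_trans[OF g h ab(1) c(1) ab(2) c(2,3)] by blast
  qed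
qed

text \<open>A maximal chain through \<open>y\<close>, seen as a curve over the full height of the
  diagram. What is kept of the chain is that each edge lies below or above \<open>y\<close>, so that
  the ends of these edges are comparable with \<open>y\<close>.\<close>

definition track :: "'a \<Rightarrow> (real \<Rightarrow> real) \<Rightarrow> bool" where
  "track y g \<longleftrightarrow> continuous_on {height z..height u} g \<and> g (height y) = abscissa y \<and>
     (\<forall>t\<in>{height z..height u}. \<exists>c d. covers L c d \<and> (d \<sqsubseteq> y \<or> y \<sqsubseteq> c) \<and> (g t, t) \<in> edge c d)"

lemma joined_by_track:
  assumes g: "joined_by z u g" and y: "g (height y) = abscissa y"
    and side: "\<And>t. t \<in> {height z..height u} \<Longrightarrow>
      \<exists>c d. covers L c d \<and> (d \<sqsubseteq> y \<or> y \<sqsubseteq> c) \<and> (g t, t) \<in> edge c d"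
  shows "track y g"
  unfolding track_def using joined_byD(1)[OF g] y side by blast

lemma track_exists:
  assumes y: "y \<in> carrier L" and "z \<noteq> u"
  shows "\<exists>g. track y g"
proof -
  have zu: "\<exists>g. joined_by z u g"
    using joined_by_exists[OF z(1) u(1) u(2)[OF z(1)] \<open>z \<noteq> u\<close>] .
  \<comment> \<open>If \<open>y\<close> is one of the bounds, one half of the chain has no edge, and
    a single curve from \<open>z\<close> to \<open>u\<close> is taken.\<close>
  consider "y = z" | "y = u" | "y \<noteq> z" "y \<noteq> u" by blast
  then show ?thesis
  proof cases
    case 1
    then show ?thesis using zu unfolding track_def joined_by_def by blast
  next
    case 2
    then show ?thesis using zu unfolding track_def joined_by_def by blast
  next
    case 3
    obtain g where g: "joined_by z y g"
      using joined_by_exists[OF z(1) y z(2)[OF y]] 3 by blast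
    obtain h where h: "joined_by y u h"
      using joined_by_exists[OF y u(1) u(2)[OF y]] 3 by blast
    let ?k = "\<lambda>t. if t \<le> height y then g t else h t"
    have "joined_by z u ?k" using joined_by_trans[OF g h z(1) y u(1) z(2)[OF y] u(2)[OF y]] .
    moreover have "?k (height y) = abscissa y" using joined_byD(3)[OF g] by simp
    moreover have "\<exists>c d. covers L c d \<and> (d \<sqsubseteq> y \<or> y \<sqsubseteq> c) \<and> (?k t, t) \<in> edge c d"
      if t: "t \<in> {height z..height u}" for t
    proof (cases "t \<le> height y")
      case True
      then obtain c d where "covers L c d" "d \<sqsubseteq> y" "(g t, t) \<in> edge c d"
        using joined_byD(4)[OF g, of t] t by auto
      then show ?thesis using True by (intro exI[of _ c] exI[of _ d]) simp
    next
      case False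
      then obtain c d where "covers L c d" "y \<sqsubseteq> c" "(h t, t) \<in> edge c d"
        using joined_byD(4)[OF h, of t] t by auto
      then show ?thesis using False by (intro exI[of _ c] exI[of _ d]) simp
    qed
    ultimately have "track y ?k" by (rule joined_by_track)
    then show ?thesis by (rule exI[of _ ?k])
  qed
qed

definition path :: "'a \<Rightarrow> real \<Rightarrow> real" where
  "path y = (SOME g. track y g)"

definition incomparable :: "'a \<Rightarrow> 'a \<Rightarrow> bool" where
  "incomparable x y \<longleftrightarrow> x \<in> carrier L \<and> y \<in> carrier L \<and> \<not> x \<sqsubseteq> y \<and> \<not> y \<sqsubseteq> x"

text \<open>The side of \<open>x\<close> is read off a path through \<open>y\<close>, which is not
  visibly symmetric; \<open>left_iff\<close> shows that a path through \<open>x\<close> gives the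
  same answer.\<close>

definition left :: "'a \<Rightarrow> 'a \<Rightarrow> bool" where
  "left x y \<longleftrightarrow> incomparable x y \<and> abscissa x < path y (height x)"

lemma incomparable_sym: "incomparable x y \<longleftrightarrow> incomparable y x"
  unfolding incomparable_def by blast

lemma incomparable_bounds: "incomparable x y \<Longrightarrow> z \<noteq> u"
  unfolding incomparable_def using z u le_trans by metis

lemma height_range: "x \<in> carrier L \<Longrightarrow> height x \<in> {height z..height u}"
  using height_le z u by simp

lemma track_path:
  assumes "incomparable x y"
  shows "track y (path y)"
proof -
  have "\<exists>g. track y g"
    using assms incomparable_bounds[OF assms] unfolding incomparable_def by (intro track_exists) auto
  then show ?thesis unfolding path_def by (rule someI_ex)
qed

lemma path_self: "incomparable x y \<Longrightarrow> path y (height y) = abscissa y"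
  using track_path unfolding track_def by blast

lemma path_edge:
  assumes "incomparable x y" "height z \<le> t" "t \<le> height u"
  obtains c d where "covers L c d" "d \<sqsubseteq> y \<or> y \<sqsubseteq> c" "(path y t, t) \<in> edge c d"
  using track_path[OF assms(1)] assms(2,3) that unfolding track_def by force

lemma path_continuous:
  assumes "incomparable x y" "height z \<le> s" "t \<le> height u"
  shows "continuous_on {s..t} (path y)"
  using track_path[OF assms(1)] assms(2,3) unfolding track_def
  by (auto intro: continuous_on_subset)

text \<open>By planarity, a vertex on the path is an end of the edge that carries it, hence
  comparable with \<open>y\<close>.\<close>

lemma path_avoids:
  assumes "incomparable x y"
  shows "path y (height x) \<noteq> abscissa x"
proof
  assume eq: "path y (height x) = abscissa x"
  have x: "x \<in> carrier L" and y: "y \<in> carrier L" using assms unfolding incomparable_def by auto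
  then obtain c d where cd: "covers L c d" "d \<sqsubseteq> y \<or> y \<sqsubseteq> c" "pos x \<in> edge c d"
    using path_edge[OF assms, of "height x"] height_range[OF x] eq by auto
  then have "x = c \<or> x = d" using vertex_on_edge x by blast
  then have "x \<sqsubseteq> y \<or> y \<sqsubseteq> x"
    using cd y le_trans[of c d y] le_trans[of y c d] by (auto simp: covers_iff)
  then show False using assms unfolding incomparable_def by blast
qed

text \<open>At a crossing strictly higher than \<open>a\<close> and strictly lower than
  \<open>b\<close>, the edge on the path of \<open>a\<close> starts at or above \<open>a\<close>,
  and the edge on the path of \<open>b\<close> ends at or below \<open>b\<close>. The two edges
  share a vertex \<open>w\<close>, and \<open>a \<sqsubseteq> w \<sqsubseteq> b\<close>.\<close>

lemma no_crossing:
  assumes inc: "incomparable a b" and h: "height a \<le> s" "s \<le> t" "t \<le> height b"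
    and prod: "(path a s - path b s) * (path a t - path b t) < 0"
  shows False
proof -
  have ab: "a \<in> carrier L" "b \<in> carrier L" and inc': "incomparable b a"
    using inc incomparable_sym unfolding incomparable_def by auto
  have rng: "height z \<le> s" "t \<le> height u" using height_range ab h by force+
  obtain r where r: "s < r" "r < t" "path a r - path b r = 0"
    using sign_change_zero[of s t "\<lambda>t. path a t - path b t"] prod h
      path_continuous[OF inc' rng] path_continuous[OF inc rng]
    by (auto intro: continuous_on_diff)
  have rr: "height z \<le> r" "r \<le> height u" using r rng by auto
  obtain c d where cd: "covers L c d" "d \<sqsubseteq> a \<or> a \<sqsubseteq> c" "(path a r, r) \<in> edge c d"
    using path_edge[OF inc' rr] by blast
  obtain e f where ef: "covers L e f" "f \<sqsubseteq> b \<or> b \<sqsubseteq> e" "(path b r, r) \<in> edge e f"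
    using path_edge[OF inc rr] by blast
  have car: "c \<in> carrier L" "d \<in> carrier L" "e \<in> carrier L" "f \<in> carrier L" "c \<sqsubseteq> d" "e \<sqsubseteq> f"
    using cd ef by (auto simp: covers_iff)
  \<comment> \<open>The alternative \<open>d \<sqsubseteq> a\<close> fails, because \<open>d\<close>
    is at height at least \<open>r\<close>, strictly higher than \<open>a\<close>.\<close>
  have "a \<sqsubseteq> c"
    using cd(2) edge_height(2)[OF cd(1,3)] height_le[OF car(2) ab(1)] r(1) h(1) by auto
  moreover have "f \<sqsubseteq> b"
    using ef(2) edge_height(1)[OF ef(1,3)] height_le[OF ab(2) car(3)] r(2) h(3) by auto
  moreover obtain w where "w \<in> {c, d}" "w \<in> {e, f}"
    using edges_meet[OF cd(1) ef(1) cd(3)] ef(3) r by auto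
  ultimately have "a \<sqsubseteq> w" "w \<sqsubseteq> b" "w \<in> carrier L"
    using car ab le_trans[of a c d] le_trans[of e f b] by auto
  then show False using inc le_trans[of a w b] ab unfolding incomparable_def by blast
qed

text \<open>At the height of the lower element its own path passes through it, at the height of the
  upper one the other path does. The two comparisons agree because the paths do not cross in
  between.\<close>

lemma left_iff:
  assumes "incomparable x y"
  shows "abscissa x < path y (height x) \<longleftrightarrow> path x (height y) < abscissa y"
proof -
  have one: "abscissa a < path b (height a) \<longleftrightarrow> path a (height b) < abscissa b"
    if ab: "incomparable a b" "height a \<le> height b" for a b
  proof -
    have ba: "incomparable b a" using ab incomparable_sym by blast
    have "\<not> (abscissa a - path b (height a)) * (path a (height b) - abscissa b) < 0"
      using no_crossing[OF ab(1), of "height a" "height b"] ab path_self[OF ab(1)] path_self[OF ba]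
      by auto
    then show ?thesis
      using path_avoids[OF ab(1)] path_avoids[OF ba] by (auto simp: mult_less_0_iff)
  qed
  have "incomparable y x" using assms incomparable_sym by blast
  then show ?thesis
    using one[of x y] one[of y x] assms path_avoids[of x y] path_avoids[of y x]
    by (metis linorder_le_cases less_asym linorder_neqE)
qed

lemma left_asym: "left x y \<Longrightarrow> \<not> left y x"
  unfolding left_def using left_iff less_asym by blast

lemma left_total: "incomparable x y \<Longrightarrow> left x y \<or> left y x"
  unfolding left_def using left_iff path_avoids incomparable_sym by (metis linorder_neqE)

text \<open>A curve from \<open>a\<close> to \<open>b\<close> that changes sides meets the path of
  \<open>y\<close> in a vertex \<open>w\<close> with
  \<open>a \<sqsubseteq> w \<sqsubseteq> b\<close>. As \<open>w\<close> is comparable with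
  \<open>y\<close>, so is \<open>a\<close> or \<open>b\<close>.\<close>

lemma comparable_same_side:
  assumes a: "incomparable a y" and b: "incomparable b y" and le: "a \<sqsubseteq> b"
    and prod: "(abscissa a - path y (height a)) * (abscissa b - path y (height b)) < 0"
  shows False
proof -
  have car: "a \<in> carrier L" "b \<in> carrier L" "y \<in> carrier L"
    using a b unfolding incomparable_def by auto
  have "a \<noteq> b" using prod by (auto simp: mult_less_0_iff)
  then obtain g where g: "joined_by a b g"
    using joined_by_exists[OF car(1,2) le] by blast
  have rng: "height z \<le> height a" "height b \<le> height u" "height a \<le> height b"
    using height_range car height_le le by force+
  obtain r where r: "height a < r" "r < height b" "g r - path y r = 0"
    using sign_change_zero[of "height a" "height b" "\<lambda>t. g t - path y t"] prod rng(3)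
      joined_byD(1-3)[OF g] path_continuous[OF a rng(1,2)] by (auto intro: continuous_on_diff)
  have rr: "height z \<le> r" "r \<le> height u" using r rng by auto
  obtain c d where cd: "covers L c d" "a \<sqsubseteq> c" "d \<sqsubseteq> b" "(g r, r) \<in> edge c d"
    using joined_byD(4)[OF g, of r] r by auto
  obtain e f where ef: "covers L e f" "f \<sqsubseteq> y \<or> y \<sqsubseteq> e" "(path y r, r) \<in> edge e f"
    using path_edge[OF a rr] by blast
  have car': "c \<in> carrier L" "d \<in> carrier L" "e \<in> carrier L" "f \<in> carrier L" "c \<sqsubseteq> d" "e \<sqsubseteq> f"
    using cd ef by (auto simp: covers_iff)
  obtain w where w: "w \<in> {c, d}" "w \<in> {e, f}"
    using edges_meet[OF cd(1) ef(1) cd(4)] ef(3) r by auto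
  have wc: "w \<in> carrier L" using w car' by auto
  have "a \<sqsubseteq> w" "w \<sqsubseteq> b"
    using w cd car car' le_trans[of a c d] le_trans[of c d b] by auto
  moreover have "w \<sqsubseteq> y \<or> y \<sqsubseteq> w"
    using w ef car car' le_trans[of e f y] le_trans[of y e f] by auto
  ultimately have "a \<sqsubseteq> y \<or> y \<sqsubseteq> b"
    using car wc le_trans[of a w y] le_trans[of y w b] by blast
  then show False using a b unfolding incomparable_def by blast
qed

text \<open>At the height of \<open>y\<close>, which is the middle one, the path of \<open>x\<close>
  is to the left of \<open>y\<close> and that of \<open>v\<close> to the right. As \<open>v\<close>
  is also to the left of \<open>x\<close>, these two paths would have to cross.\<close>

lemma left_acyclic_aux:
  assumes xy: "left x y" and yz: "left y v" and zx: "left v x"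
    and h: "height x \<le> height y \<and> height y \<le> height v \<or> height v \<le> height y \<and> height y \<le> height x"
  shows False
proof -
  have i: "incomparable x y" "incomparable y v" "incomparable v x" "incomparable x v" "incomparable v y"
    using assms incomparable_sym unfolding left_def by auto
  have l: "path x (height y) < abscissa y" "abscissa y < path v (height y)"
     "path v (height x) < abscissa x" "abscissa v < path x (height v)"
    using xy yz zx i left_iff unfolding left_def by auto
  have s: "path x (height x) = abscissa x" "path v (height v) = abscissa v"
    using i path_self by blast+
  from h show False
  proof
    assume "height x \<le> height y \<and> height y \<le> height v"
    then show False using no_crossing[OF i(4), of "height x" "height y"] l s
      by (auto simp: mult_less_0_iff)
  next
    assume "height v \<le> height y \<and> height y \<le> height x"
    then show False using no_crossing[OF i(3), of "height v" "height y"] l s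
      by (auto simp: mult_less_0_iff)
  qed
qed

lemma left_trans:
  assumes xy: "left x y" and yv: "left y v"
  shows "left x v"
proof -
  have i: "incomparable x y" "incomparable y v" "incomparable v y"
    using assms incomparable_sym unfolding left_def by auto
  have l: "abscissa x < path y (height x)" "path y (height v) < abscissa v"
    using xy yv left_iff unfolding left_def by auto
  \<comment> \<open>\<open>x\<close> and \<open>v\<close> are on opposite sides of the path of
    \<open>y\<close>, so they are incomparable.\<close>
  have "\<not> x \<sqsubseteq> v" using comparable_same_side[OF i(1) i(3)] l by (auto simp: mult_less_0_iff)
  moreover have "\<not> v \<sqsubseteq> x"
    using comparable_same_side[OF i(3) i(1)] l by (auto simp: mult_less_0_iff)
  ultimately have "incomparable x v" using i unfolding incomparable_def by blast
  moreover have "\<not> left v x"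
  proof
    assume vx: "left v x"
    \<comment> \<open>One of the three rotations of the cycle puts the element of middle height in
      the middle.\<close>
    show False
      using left_acyclic_aux[OF xy yv vx] left_acyclic_aux[OF yv vx xy] left_acyclic_aux[OF vx xy yv]
      by linarith
  qed
  ultimately show ?thesis using left_total by blast
qed

lemma realizer_exists: "\<exists>f g. realizer L f g"
proof (rule realizer_of_conjugate[where l = left])
  show "\<not> x \<sqsubseteq> y \<and> \<not> y \<sqsubseteq> x \<longleftrightarrow> left x y \<or> left y x" if "x \<in> carrier L" "y \<in> carrier L" for x y
    using left_total[of x y] that unfolding left_def incomparable_def by blast
qed (use left_asym left_trans in blast)+

end

lemma planar_lattice_realizer:
  assumes "planar_lattice L"
  shows "\<exists>f g. realizer L f g"
proof -
  interpret lattice L using assms unfolding planar_lattice_def finite_lattice_def by blast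
  obtain pos where pos: "planar_diagram L pos" and fin: "finite (carrier L)" "carrier L \<noteq> {}"
    using assms unfolding planar_lattice_def finite_lattice_def by blast
  obtain z u where "z \<in> carrier L" "u \<in> carrier L"
    "\<And>x. x \<in> carrier L \<Longrightarrow> z \<sqsubseteq>\<^bsub>L\<^esub> x" "\<And>x. x \<in> carrier L \<Longrightarrow> x \<sqsubseteq>\<^bsub>L\<^esub> u"
    using finite_bounds[OF fin] by blast
  then interpret bounded_planar_diagram L pos z u
    using pos fin by unfold_locales auto
  show ?thesis by (rule realizer_exists)
qed

section \<open>The dominance drawing of a lattice with two linear orders\<close>

definition dominance_pos :: "('a \<Rightarrow> real) \<Rightarrow> ('a \<Rightarrow> real) \<Rightarrow> 'a \<Rightarrow> real \<times> real" where
  "dominance_pos f g x = (f x - g x, f x + g x)"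

text \<open>Sum and difference of the coordinates undo the rotation, so points on an edge are
  described by one equation in \<open>f\<close> and one in \<open>g\<close>.\<close>

lemma dominance_segment:
  "p \<in> closed_segment (dominance_pos f g x) (dominance_pos f g y) \<longleftrightarrow>
     (\<exists>t. 0 \<le> t \<and> t \<le> 1 \<and> snd p + fst p = 2 * (f x + t * (f y - f x)) \<and>
        snd p - fst p = 2 * (g x + t * (g y - g x)))"
proof -
  obtain a b where p: "p = (a, b)" by (cases p)
  have "p = (1 - t) *\<^sub>R dominance_pos f g x + t *\<^sub>R dominance_pos f g y \<longleftrightarrow>
      snd p + fst p = 2 * (f x + t * (f y - f x)) \<and> snd p - fst p = 2 * (g x + t * (g y - g x))" for t
    unfolding p dominance_pos_def by (auto simp: algebra_simps)
  then show ?thesis unfolding closed_segment_def by auto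
qed

lemma convex_combination_bounds:
  fixes a b t :: real
  assumes "0 \<le> t" "t \<le> 1" "a \<le> b"
  shows "a \<le> a + t * (b - a)" "a + t * (b - a) \<le> b"
proof -
  have "b - (a + t * (b - a)) = (1 - t) * (b - a)" by (simp add: algebra_simps)
  moreover have "0 \<le> (1 - t) * (b - a)" "0 \<le> t * (b - a)" using assms by simp_all
  ultimately show "a \<le> a + t * (b - a)" "a + t * (b - a) \<le> b" by simp_all
qed

text \<open>The directions \<open>(a, b)\<close> and \<open>(c, d)\<close> have determinant
  \<open>a * d - c * b < 0\<close>, so the two rays are not parallel.\<close>

lemma rays_meet_at_origin:
  fixes a b c d t s :: real
  assumes "0 < a" "a < c" "0 < d" "d < b" "0 \<le> t" "t * a = s * c" "t * b = s * d"
  shows "t = 0"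
proof (rule ccontr)
  assume "t \<noteq> 0"
  then have "0 < t" using assms by simp
  have "t * (a * d) = (t * a) * d" by simp
  also have "\<dots> = c * (t * b)" unfolding assms(6,7) by simp
  also have "\<dots> = t * (c * b)" by simp
  finally have "a * d = c * b" using \<open>0 < t\<close> by simp
  moreover have "a * d < c * b" using assms by (intro mult_strict_mono) auto
  ultimately show False by simp
qed

text \<open>In the coordinates \<open>f\<close>, \<open>g\<close> an edge lies in the box spanned by
  its ends. If the edges from \<open>x\<close> to \<open>y\<close> and from \<open>u\<close> to
  \<open>v\<close> share a point, both lower ends are below both upper ends, so the join of
  \<open>x\<close> and \<open>u\<close> lies in both intervals and is a common end of the two
  edges.\<close>

lemma planar_diagram_dominance:
  fixes P :: "'a gorder"
  assumes P: "lattice P" and fg: "realizer P f g"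
  shows "planar_diagram P (dominance_pos f g)"
proof -
  interpret lattice P by (fact P)
  let ?pos = "dominance_pos f g"
  note le_iff = fg[unfolded realizer_def, THEN conjunct2, THEN conjunct2, rule_format]
  have f_eq: "x = y" if "x \<in> carrier P" "y \<in> carrier P" "f x = f y" for x y
    using fg that unfolding realizer_def inj_on_def by blast
  have g_eq: "x = y" if "x \<in> carrier P" "y \<in> carrier P" "g x = g y" for x y
    using fg that unfolding realizer_def inj_on_def by blast
  have coverD: "x \<in> carrier P" "y \<in> carrier P" "f x < f y" "g x < g y" "x \<noteq> y"
      "\<And>w. w \<in> carrier P \<Longrightarrow> x \<sqsubseteq>\<^bsub>P\<^esub> w \<Longrightarrow> w \<sqsubseteq>\<^bsub>P\<^esub> y \<Longrightarrow> w = x \<or> w = y" if "covers P x y" for x y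
    using that le_iff[of x y] f_eq[of x y] g_eq[of x y] unfolding covers_def lless_eq by force+
  have segE: "\<exists>t. 0 \<le> t \<and> t \<le> 1 \<and> snd p + fst p = 2 * (f x + t * (f y - f x)) \<and>
        snd p - fst p = 2 * (g x + t * (g y - g x))"
    if "p \<in> closed_segment (?pos x) (?pos y)" for p x y
    using that dominance_segment by metis
  have pos_eqI: "p = ?pos x" if "snd p + fst p = 2 * f x" "snd p - fst p = 2 * g x" for p x
    using that unfolding dominance_pos_def by (auto simp: prod_eq_iff)
  have box: "2 * f x \<le> snd p + fst p" "snd p + fst p \<le> 2 * f y"
      "2 * g x \<le> snd p - fst p" "snd p - fst p \<le> 2 * g y"
    if c: "covers P x y" and p: "p \<in> closed_segment (?pos x) (?pos y)" for p x y
  proof -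
    obtain t where "0 \<le> t" "t \<le> 1" "snd p + fst p = 2 * (f x + t * (f y - f x))"
        "snd p - fst p = 2 * (g x + t * (g y - g x))"
      using segE[OF p] by blast
    then show "2 * f x \<le> snd p + fst p" "snd p + fst p \<le> 2 * f y"
      "2 * g x \<le> snd p - fst p" "snd p - fst p \<le> 2 * g y"
      using convex_combination_bounds[of t "f x" "f y"] convex_combination_bounds[of t "g x" "g y"]
        coverD[OF c] by auto
  qed
  have incomp: "f a < f b \<and> g b < g a \<or> f b < f a \<and> g a < g b"
    if "a \<in> carrier P" "b \<in> carrier P" "\<not> a \<sqsubseteq>\<^bsub>P\<^esub> b" "\<not> b \<sqsubseteq>\<^bsub>P\<^esub> a" for a b
    using that le_iff[of a b] le_iff[of b a] by auto
  \<comment> \<open>Two covers of \<open>x\<close> are incomparable, so one has the larger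
    \<open>f\<close> and the other the larger \<open>g\<close>; the rays from \<open>x\<close>
    towards them meet only in \<open>x\<close>.\<close>
  have fork: "p = ?pos x"
    if a: "covers P x a" and b: "covers P x b" and ab: "a \<noteq> b"
      and p: "p \<in> closed_segment (?pos x) (?pos a)" "p \<in> closed_segment (?pos x) (?pos b)" for p x a b
  proof -
    obtain t where t: "0 \<le> t" "snd p + fst p = 2 * (f x + t * (f a - f x))"
        "snd p - fst p = 2 * (g x + t * (g a - g x))"
      using segE[OF p(1)] by blast
    obtain s where s: "0 \<le> s" "snd p + fst p = 2 * (f x + s * (f b - f x))"
        "snd p - fst p = 2 * (g x + s * (g b - g x))"
      using segE[OF p(2)] by blast
    have eq: "t * (f a - f x) = s * (f b - f x)" "t * (g a - g x) = s * (g b - g x)"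
      using t s by auto
    have "\<not> a \<sqsubseteq>\<^bsub>P\<^esub> b" "\<not> b \<sqsubseteq>\<^bsub>P\<^esub> a"
      using coverD[OF a] coverD[OF b] ab le_iff by (metis less_imp_le)+
    then have "t = 0 \<or> s = 0"
      using incomp[of a b] coverD[OF a] coverD[OF b] eq t(1) s(1)
        rays_meet_at_origin[of "f a - f x" "f b - f x" "g b - g x" "g a - g x" t s]
        rays_meet_at_origin[of "f b - f x" "f a - f x" "g a - g x" "g b - g x" s t] by auto
    then show ?thesis using t s by (auto intro: pos_eqI)
  qed
  have join: "p = ?pos x"
    if a: "covers P a x" and b: "covers P b x" and ab: "a \<noteq> b"
      and p: "p \<in> closed_segment (?pos a) (?pos x)" "p \<in> closed_segment (?pos b) (?pos x)" for p x a b
  proof -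
    have p': "p \<in> closed_segment (?pos x) (?pos a)" "p \<in> closed_segment (?pos x) (?pos b)"
      using p closed_segment_commute by metis+
    obtain t where t: "0 \<le> t" "snd p + fst p = 2 * (f x + t * (f a - f x))"
        "snd p - fst p = 2 * (g x + t * (g a - g x))"
      using segE[OF p'(1)] by blast
    obtain s where s: "0 \<le> s" "snd p + fst p = 2 * (f x + s * (f b - f x))"
        "snd p - fst p = 2 * (g x + s * (g b - g x))"
      using segE[OF p'(2)] by blast
    have "t * (f a - f x) = s * (f b - f x)" "t * (g a - g x) = s * (g b - g x)"
      using t s by auto
    then have eq: "t * (f x - f a) = s * (f x - f b)" "t * (g x - g a) = s * (g x - g b)"
      by (simp_all add: algebra_simps)
    have "\<not> a \<sqsubseteq>\<^bsub>P\<^esub> b" "\<not> b \<sqsubseteq>\<^bsub>P\<^esub> a"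
      using coverD[OF a] coverD[OF b] ab le_iff by (metis less_imp_le)+
    then have "t = 0 \<or> s = 0"
      using incomp[of a b] coverD[OF a] coverD[OF b] eq t(1) s(1)
        rays_meet_at_origin[of "f x - f a" "f x - f b" "g x - g b" "g x - g a" t s]
        rays_meet_at_origin[of "f x - f b" "f x - f a" "g x - g a" "g x - g b" s t] by auto
    then show ?thesis using t s by (auto intro: pos_eqI)
  qed
  have inj: "inj_on ?pos (carrier P)"
    using f_eq by (auto simp: inj_on_def dominance_pos_def)
  have mono: "snd (?pos x) < snd (?pos y)" if "x \<in> carrier P" "y \<in> carrier P" "x \<sqsubset>\<^bsub>P\<^esub> y" for x y
    using that le_iff[of x y] f_eq[of x y] g_eq[of x y]
    unfolding lless_eq dominance_pos_def by fastforce
  have vertex: "v \<in> {x, y}"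
    if c: "covers P x y" and v: "v \<in> carrier P" "?pos v \<in> closed_segment (?pos x) (?pos y)" for x y v
  proof -
    have "x \<sqsubseteq>\<^bsub>P\<^esub> v" "v \<sqsubseteq>\<^bsub>P\<^esub> y"
      using box[OF c v(2)] le_iff coverD(1,2)[OF c] v(1) by (auto simp: dominance_pos_def)
    then show ?thesis using coverD(6)[OF c v(1)] by blast
  qed
  have cross: "p \<in> ?pos ` ({x, y} \<inter> {u, v})"
    if xy: "covers P x y" and uv: "covers P u v" and ne: "(x, y) \<noteq> (u, v)"
      and p: "p \<in> closed_segment (?pos x) (?pos y)" "p \<in> closed_segment (?pos u) (?pos v)" for x y u v p
  proof -
    note c1 = coverD[OF xy] and c2 = coverD[OF uv]
    note b1 = box[OF xy p(1)] and b2 = box[OF uv p(2)]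
    have le: "x \<sqsubseteq>\<^bsub>P\<^esub> v" "u \<sqsubseteq>\<^bsub>P\<^esub> y" "x \<sqsubseteq>\<^bsub>P\<^esub> y" "u \<sqsubseteq>\<^bsub>P\<^esub> v"
      using le_iff c1 c2 b1 b2 by auto
    have "x \<squnion>\<^bsub>P\<^esub> u \<in> carrier P" "x \<sqsubseteq>\<^bsub>P\<^esub> x \<squnion>\<^bsub>P\<^esub> u" "u \<sqsubseteq>\<^bsub>P\<^esub> x \<squnion>\<^bsub>P\<^esub> u" "x \<squnion>\<^bsub>P\<^esub> u \<sqsubseteq>\<^bsub>P\<^esub> y" "x \<squnion>\<^bsub>P\<^esub> u \<sqsubseteq>\<^bsub>P\<^esub> v"
      using c1 c2 le by (auto simp: join_left join_right join_le)
    then have "x \<squnion>\<^bsub>P\<^esub> u \<in> {x, y}" "x \<squnion>\<^bsub>P\<^esub> u \<in> {u, v}"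
      using c1(6) c2(6) by blast+
    then consider "x = u" | "x = v" | "y = u" | "y = v" by auto
    then show ?thesis
    proof cases
      case 1
      then show ?thesis using fork[of x y v p] xy uv ne p by auto
    next
      case 2
      \<comment> \<open>The upper end of one edge is the lower end of the other, and their boxes
        meet only in this corner.\<close>
      then have "p = ?pos x" using b1 b2 by (intro pos_eqI) auto
      then show ?thesis using 2 by auto
    next
      case 3
      then have "p = ?pos y" using b1 b2 by (intro pos_eqI) auto
      then show ?thesis using 3 by auto
    next
      case 4
      then show ?thesis using join[of x y u p] xy uv ne p by auto
    qed
  qed
  show ?thesis
    unfolding planar_diagram_def
  proof (intro conjI ballI allI impI subsetI)
    fix x y u v p
    assume "covers P x y \<and> covers P u v \<and> (x, y) \<noteq> (u, v)"
      "p \<in> closed_segment (?pos x) (?pos y) \<inter> closed_segment (?pos u) (?pos v)"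
    then show "p \<in> ?pos ` ({x, y} \<inter> {u, v})" using cross by blast
  qed (use inj mono vertex in blast)+
qed

text \<open>A point over \<open>a\<close> strictly to the right of a point over \<open>b\<close> at
  the same height would have the larger \<open>f\<close> and the smaller \<open>g\<close>. For
  segments with a common end this contradicts their directions, for the other pairs the bounds on
  \<open>f\<close> or on \<open>g\<close>.\<close>

lemma left_of_dominance_cell:
  assumes "f u < f a" "f a < f b" "f b < f v" "g u < g b" "g b < g a" "g a < g v"
  shows "left_of (chain_path (dominance_pos f g) u a v) (chain_path (dominance_pos f g) u b v)"
  unfolding left_of_def
proof (intro ballI impI)
  let ?pos = "dominance_pos f g"
  fix p q
  assume p: "p \<in> chain_path ?pos u a v" and q: "q \<in> chain_path ?pos u b v" and pq: "snd p = snd q"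
  \<comment> \<open>The inequality \<open>F\<close> forces \<open>s < t\<close> because
    \<open>A < C\<close>, and \<open>G\<close> forces \<open>t < s\<close> because
    \<open>D < B\<close>.\<close>
  have low: False
    if c: "0 < A" "A < C" "0 < D" "D < B" and t: "0 \<le> t" "0 \<le> s"
      and F: "s * C < t * A" and G: "t * B < s * D" for A B C D t s :: real
  proof -
    have "s * C < t * C" using F mult_left_mono[of A C t] c t by linarith
    then have "s < t" using c by simp
    moreover have "t * D < s * D" using G mult_left_mono[of D B t] c t by linarith
    then have "t < s" using c by simp
    ultimately show False by simp
  qed
  show "fst p \<le> fst q"
  proof (rule ccontr)
    assume n: "\<not> fst p \<le> fst q"
    have cmp: "snd q + fst q < snd p + fst p" "snd p - fst p < snd q - fst q" using n pq by auto
    consider "p \<in> closed_segment (?pos u) (?pos a)" "q \<in> closed_segment (?pos u) (?pos b)"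
      | "p \<in> closed_segment (?pos u) (?pos a)" "q \<in> closed_segment (?pos b) (?pos v)"
      | "p \<in> closed_segment (?pos a) (?pos v)" "q \<in> closed_segment (?pos u) (?pos b)"
      | "p \<in> closed_segment (?pos v) (?pos a)" "q \<in> closed_segment (?pos v) (?pos b)"
      using p q unfolding chain_path_def by (metis Un_iff closed_segment_commute)
    then show False
    proof cases
      case 1
      then obtain t s where "0 \<le> t" "0 \<le> s" "snd p + fst p = 2 * (f u + t * (f a - f u))"
          "snd p - fst p = 2 * (g u + t * (g a - g u))" "snd q + fst q = 2 * (f u + s * (f b - f u))"
          "snd q - fst q = 2 * (g u + s * (g b - g u))"
        unfolding dominance_segment by blast
      then show False
        using low[of "f a - f u" "f b - f u" "g b - g u" "g a - g u" t s] assms cmp by auto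
    next
      case 2
      then obtain t s where ts: "0 \<le> t" "t \<le> 1" "0 \<le> s" "s \<le> 1"
          "snd p + fst p = 2 * (f u + t * (f a - f u))"
          "snd q + fst q = 2 * (f b + s * (f v - f b))"
        unfolding dominance_segment by blast
      have "snd p + fst p \<le> 2 * f a" "2 * f b \<le> snd q + fst q"
        unfolding ts(5,6)
        using convex_combination_bounds[of t "f u" "f a"]
          convex_combination_bounds[of s "f b" "f v"] ts(1-4) assms by simp_all
      then show False using assms cmp by linarith
    next
      case 3
      then obtain t s where ts: "0 \<le> t" "t \<le> 1" "0 \<le> s" "s \<le> 1"
          "snd p - fst p = 2 * (g a + t * (g v - g a))"
          "snd q - fst q = 2 * (g u + s * (g b - g u))"
        unfolding dominance_segment by blast
      have "2 * g a \<le> snd p - fst p" "snd q - fst q \<le> 2 * g b"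
        unfolding ts(5,6)
        using convex_combination_bounds[of t "g a" "g v"]
          convex_combination_bounds[of s "g u" "g b"] ts(1-4) assms by simp_all
      then show False using assms cmp by linarith
    next
      \<comment> \<open>Both segments are parametrised downwards from \<open>v\<close>: this is the
        first case turned upside down, with \<open>a\<close> and \<open>b\<close> exchanged.\<close>
      case 4
      then obtain t s where ts: "0 \<le> t" "0 \<le> s" and eq: "snd p + fst p = 2 * (f v + t * (f a - f v))"
          "snd p - fst p = 2 * (g v + t * (g a - g v))" "snd q + fst q = 2 * (f v + s * (f b - f v))"
          "snd q - fst q = 2 * (g v + s * (g b - g v))"
        unfolding dominance_segment by blast
      have "t * (f v - f a) < s * (f v - f b)" "s * (g v - g b) < t * (g v - g a)"
        using eq cmp by (auto simp: algebra_simps)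
      then show False
        using low[of "f v - f b" "f v - f a" "g v - g a" "g v - g b" s t] assms ts by auto
    qed
  qed
qed

text \<open>The inside of a set is disjoint from the set and contained in every convex set around
  it. The convex set \<open>T\<close> is the box from \<open>u\<close> to \<open>v\<close>, cut out
  by four half-planes.\<close>

lemma inside_dominance_cell:
  assumes "f u \<le> f a" "f a \<le> f v" "f u \<le> f b" "f b \<le> f v"
    and "g u \<le> g a" "g a \<le> g v" "g u \<le> g b" "g b \<le> g v"
    and x: "dominance_pos f g x \<in>
      inside (chain_path (dominance_pos f g) u a v \<union> chain_path (dominance_pos f g) u b v)"
  shows "f u \<le> f x \<and> f x \<le> f v \<and> g u \<le> g x \<and> g x \<le> g v \<and> x \<noteq> u \<and> x \<noteq> a \<and> x \<noteq> b \<and> x \<noteq> v"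
proof -
  let ?pos = "dominance_pos f g"
  let ?S = "chain_path ?pos u a v \<union> chain_path ?pos u b v"
  define T where "T = {p::real \<times> real. (1, 1) \<bullet> p \<le> 2 * f v} \<inter> {p. (-1, 1) \<bullet> p \<le> 2 * g v} \<inter>
    {p. (-1, -1) \<bullet> p \<le> - 2 * f u} \<inter> {p. (1, -1) \<bullet> p \<le> - 2 * g u}"
  have T: "?pos y \<in> T \<longleftrightarrow> f u \<le> f y \<and> f y \<le> f v \<and> g u \<le> g y \<and> g y \<le> g v" for y
    by (auto simp: T_def dominance_pos_def)
  have "convex T" unfolding T_def by (intro convex_Int convex_halfspace_le)
  moreover from this have "?S \<subseteq> T"
    unfolding chain_path_def using T assms(1-8)
    by (intro Un_least closed_segment_subset) auto
  ultimately have "?pos x \<in> T"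
    using outside_subset_convex[of T ?S] x inside_Int_outside[of ?S] by blast
  moreover have "?pos x \<notin> ?S" using x inside_no_overlap[of ?S] by blast
  then have "x \<noteq> u \<and> x \<noteq> a \<and> x \<noteq> b \<and> x \<noteq> v" unfolding chain_path_def by auto
  ultimately show ?thesis using T by blast
qed

section \<open>Semimodular lattices with two linear orders\<close>

text \<open>In a planar semimodular lattice these are the interior elements of the covering
  \<open>M_n\<close>, the ones that step (3) adds. Betweenness in \<open>f\<close> is enough, since
  \<open>g\<close> orders the covers of an element the opposite way.\<close>

definition inner_cover :: "'a gorder \<Rightarrow> ('a \<Rightarrow> real) \<Rightarrow> 'a \<Rightarrow> bool" where
  "inner_cover P f b \<longleftrightarrow>
     (\<exists>u a c. covers P u a \<and> covers P u b \<and> covers P u c \<and> f a < f b \<and> f b < f c)"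

text \<open>For \<open>f\<close> this is the leftmost upper cover, for \<open>g\<close> the
  rightmost one.\<close>

definition least_cover :: "'a gorder \<Rightarrow> ('a \<Rightarrow> real) \<Rightarrow> 'a \<Rightarrow> 'a \<Rightarrow> bool" where
  "least_cover P f x y \<longleftrightarrow> covers P x y \<and> (\<forall>w. covers P x w \<longrightarrow> f y \<le> f w)"

text \<open>The sequence becomes constant once it reaches the greatest element.\<close>

primrec boundary_chain :: "'a gorder \<Rightarrow> ('a \<Rightarrow> real) \<Rightarrow> 'a \<Rightarrow> nat \<Rightarrow> 'a" where
  "boundary_chain P f x 0 = x"
| "boundary_chain P f x (Suc i) =
     (if \<exists>y. least_cover P f (boundary_chain P f x i) y
      then SOME y. least_cover P f (boundary_chain P f x i) y
      else boundary_chain P f x i)"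

declare boundary_chain.simps(2) [simp del]

locale semimodular_realized = lattice L for L :: "'a gorder" (structure) +
  fixes f g :: "'a \<Rightarrow> real" and z u :: 'a
  assumes finite_L: "finite (carrier L)"
    and z: "z \<in> carrier L" "\<And>x. x \<in> carrier L \<Longrightarrow> z \<sqsubseteq> x"
    and u: "u \<in> carrier L" "\<And>x. x \<in> carrier L \<Longrightarrow> x \<sqsubseteq> u"
    and semimodular_L: "semimodular L"
    and realizer_L: "realizer L f g"

sublocale semimodular_realized \<subseteq> finite_order L
  by unfold_locales (rule finite_L)

context semimodular_realized
begin

text \<open>Reflection in a vertical line: facts about leftmost covers and the left chain become
  facts about rightmost covers and the right chain.\<close>

lemma swapped: "semimodular_realized L g f z u"
proof unfold_locales
  show "realizer L g f" using realizer_L unfolding realizer_def by blast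
qed (use finite_L z u semimodular_L in auto)

lemma le_iff: "x \<in> carrier L \<Longrightarrow> y \<in> carrier L \<Longrightarrow> x \<sqsubseteq> y \<longleftrightarrow> f x \<le> f y \<and> g x \<le> g y"
  using realizer_L unfolding realizer_def by blast

lemma f_inj: "x \<in> carrier L \<Longrightarrow> y \<in> carrier L \<Longrightarrow> f x = f y \<Longrightarrow> x = y"
  using realizer_L unfolding realizer_def inj_on_def by blast

lemma g_inj: "x \<in> carrier L \<Longrightarrow> y \<in> carrier L \<Longrightarrow> g x = g y \<Longrightarrow> x = y"
  using realizer_L unfolding realizer_def inj_on_def by blast

lemma coversD:
  assumes "covers L x y"
  shows "x \<in> carrier L" "y \<in> carrier L" "x \<sqsubseteq> y" "x \<noteq> y" "f x < f y" "g x < g y"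
  using assms le_iff[of x y] f_inj[of x y] g_inj[of x y] unfolding covers_iff by force+

lemma covers_between: "covers L x y \<Longrightarrow> w \<in> carrier L \<Longrightarrow> x \<sqsubseteq> w \<Longrightarrow> w \<sqsubseteq> y \<Longrightarrow> w = x \<or> w = y"
  unfolding covers_iff by blast

lemma covers_incomparable:
  assumes "covers L x a" "covers L x b" "a \<noteq> b"
  shows "\<not> a \<sqsubseteq> b"
  using assms covers_between[of x b a] coversD by blast

text \<open>Distinct covers of one element are incomparable, so \<open>f\<close> and
  \<open>g\<close> disagree on them.\<close>

lemma covers_f_less_iff:
  assumes "covers L x a" "covers L x b"
  shows "f a < f b \<longleftrightarrow> g b < g a"
proof (cases "a = b")
  case False
  then have "\<not> a \<sqsubseteq> b" "\<not> b \<sqsubseteq> a" using assms covers_incomparable by blast+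
  then show ?thesis using le_iff coversD(2)[OF assms(1)] coversD(2)[OF assms(2)] by force
qed simp

lemma covers_eq_join:
  assumes "covers_eq L a b" "b \<in> carrier L" "c \<in> carrier L"
  shows "covers_eq L (a \<squnion> c) (b \<squnion> c)"
  using assms semimodular_L coversD unfolding semimodular_def covers_eq_def by blast

text \<open>Semimodularity where \<open>c\<close> absorbs \<open>a\<close>: either
  \<open>b \<squnion> c\<close> covers \<open>c\<close> or the two are equal, and equality would put
  \<open>b\<close> below \<open>c\<close>.\<close>

lemma covers_join_absorb:
  assumes "covers L a b" "c \<in> carrier L" "a \<sqsubseteq> c" "\<not> b \<sqsubseteq> c"
  shows "covers L c (b \<squnion> c)"
proof -
  have "covers_eq L (a \<squnion> c) (b \<squnion> c)"
    using covers_eq_join[of a b c] assms coversD unfolding covers_eq_def by blast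
  moreover have "a \<squnion> c = c"
    using assms coversD[OF assms(1)] by (intro join_eqI) auto
  moreover have "b \<squnion> c \<noteq> c" using join_left[of b c] assms coversD[OF assms(1)] by auto
  ultimately show ?thesis unfolding covers_eq_def by auto
qed

lemma covers_join:
  assumes "covers L x a" "covers L x b" "a \<noteq> b"
  shows "covers L a (a \<squnion> b)" "covers L b (a \<squnion> b)"
  using covers_join_absorb[of x b a] covers_join_absorb[of x a b] covers_incomparable assms coversD
  by (metis join_comm)+

lemma join_covers_eqI:
  assumes a: "covers L x a" and b: "covers L x b" and "a \<noteq> b" and v: "covers L a v" and "b \<sqsubseteq> v"
  shows "a \<squnion> b = v"
proof -
  have le: "a \<squnion> b \<sqsubseteq> v"
    using join_le[OF coversD(3)[OF v] \<open>b \<sqsubseteq> v\<close> coversD(2)[OF a] coversD(2)[OF b] coversD(2)[OF v]] .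
  note ab = coversD[OF covers_join(1)[OF a b \<open>a \<noteq> b\<close>]]
  show ?thesis using covers_between[OF v ab(2,3) le] ab(4) by simp
qed

lemma inner_cover_swap: "inner_cover L g b \<longleftrightarrow> inner_cover L f b"
proof
  assume "inner_cover L g b"
  then obtain x a c where w: "covers L x a" "covers L x b" "covers L x c" "g a < g b" "g b < g c"
    unfolding inner_cover_def by blast
  then have "f c < f b" "f b < f a"
    using covers_f_less_iff[OF w(3,2)] covers_f_less_iff[OF w(2,1)] by simp_all
  then show "inner_cover L f b" unfolding inner_cover_def using w(1-3) by blast
next
  assume "inner_cover L f b"
  then obtain x a c where w: "covers L x a" "covers L x b" "covers L x c" "f a < f b" "f b < f c"
    unfolding inner_cover_def by blast
  then have "g c < g b" "g b < g a"
    using covers_f_less_iff[OF w(2,3)] covers_f_less_iff[OF w(1,2)] by simp_all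
  then show "inner_cover L g b" unfolding inner_cover_def using w(1-3) by blast
qed

section \<open>An upper cover strictly between two others\<close>

context
  fixes x a b c
  assumes cov: "covers L x a" "covers L x b" "covers L x c" and between: "f a < f b" "f b < f c"
begin

lemma inner_carrier: "x \<in> carrier L" "a \<in> carrier L" "b \<in> carrier L" "c \<in> carrier L"
    "a \<squnion> c \<in> carrier L"
  using coversD(1,2)[OF cov(1)] coversD(2)[OF cov(2)] coversD(2)[OF cov(3)] by simp_all

lemma inner_g: "g b < g a" "g c < g b"
  using covers_f_less_iff[OF cov(1,2)] covers_f_less_iff[OF cov(2,3)] between by simp_all

lemma inner_join_bounds: "f c \<le> f (a \<squnion> c)" "g a \<le> g (a \<squnion> c)"
  using le_iff[OF inner_carrier(4,5)] le_iff[OF inner_carrier(2,5)]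
    join_right[OF inner_carrier(2,4)] join_left[OF inner_carrier(2,4)] by simp_all

lemma inner_neq: "a \<noteq> b" "a \<noteq> c" "b \<noteq> c"
  using between by auto

text \<open>Each coordinate of \<open>b\<close> is exceeded by that of \<open>a\<close> or
  \<open>c\<close>: \<open>f b < f c\<close> and \<open>g b < g a\<close>.\<close>

lemma inner_le_join: "b \<sqsubseteq> a \<squnion> c"
  using le_iff[OF inner_carrier(3,5)] inner_join_bounds between inner_g by simp

lemma inner_joins: "a \<squnion> b = a \<squnion> c" "c \<squnion> b = a \<squnion> c"
  using join_covers_eqI[OF cov(1,2) inner_neq(1) covers_join(1)[OF cov(1,3) inner_neq(2)] inner_le_join]
    join_covers_eqI[OF cov(3,2) inner_neq(3)[symmetric] covers_join(2)[OF cov(1,3) inner_neq(2)] inner_le_join]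
  by auto

text \<open>A cover \<open>w\<close> of \<open>b\<close> that is above \<open>a\<close> or
  \<open>c\<close> is above \<open>a \<squnion> c\<close>, hence equal to it. Otherwise
  \<open>f w < f c\<close> and \<open>g w < g a\<close>, which places \<open>w\<close> below
  \<open>a \<squnion> c\<close>, itself a cover of \<open>b\<close>.\<close>

lemma inner_upper_cover: "covers L b w \<longleftrightarrow> w = a \<squnion> c"
proof
  assume "w = a \<squnion> c"
  then show "covers L b w"
    using covers_join(2)[OF cov(1,2) inner_neq(1)] inner_joins by simp
next
  assume w: "covers L b w"
  note wD = coversD[OF w]
  have bv: "covers L b (a \<squnion> c)" using covers_join(2)[OF cov(1,2) inner_neq(1)] inner_joins by simp
  have le: "w = a \<squnion> c" if "d \<sqsubseteq> w" "d = a \<or> d = c" for d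
  proof -
    have "d \<squnion> b \<sqsubseteq> w" using that wD inner_carrier by (auto intro: join_le)
    then have "a \<squnion> c \<sqsubseteq> w" using inner_joins that(2) by auto
    then show ?thesis using covers_between[OF w, of "a \<squnion> c"] coversD[OF bv] by auto
  qed
  show "w = a \<squnion> c"
  proof (rule ccontr)
    assume neq: "w \<noteq> a \<squnion> c"
    have "\<not> a \<sqsubseteq> w" "\<not> c \<sqsubseteq> w" using le neq by blast+
    then have "g w < g a" "f w < f c"
      using le_iff[OF inner_carrier(2) wD(2)] le_iff[OF inner_carrier(4) wD(2)] wD(5,6) between inner_g
      by auto
    then have "w \<sqsubseteq> a \<squnion> c" using le_iff[OF wD(2) inner_carrier(5)] inner_join_bounds by simp
    then show False using covers_between[OF bv, of w] wD neq by auto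
  qed
qed

text \<open>If \<open>w\<close> is below \<open>a\<close> or \<open>c\<close>, it is below the meet
  of that element with \<open>b\<close>, which is \<open>x\<close>. Otherwise \<open>w\<close> is to
  the right of \<open>a\<close> and to the left of \<open>c\<close>; this places it above
  \<open>x\<close>, strictly between \<open>x\<close> and \<open>b\<close>.\<close>

lemma inner_lower_cover: "covers L w b \<longleftrightarrow> w = x"
proof
  assume w: "covers L w b"
  note wD = coversD[OF w]
  have le: "w = x" if "w \<sqsubseteq> d" "d = a \<or> d = c" for d
  proof -
    have d: "covers L x d" "d \<noteq> b" using that cov inner_neq by auto
    note dD = coversD[OF d(1)]
    have m: "d \<sqinter> b \<in> carrier L" "x \<sqsubseteq> d \<sqinter> b" "d \<sqinter> b \<sqsubseteq> b" "d \<sqinter> b \<sqsubseteq> d" "w \<sqsubseteq> d \<sqinter> b"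
      using dD inner_carrier coversD(3)[OF cov(2)] wD that(1)
      by (auto simp: meet_left meet_right intro: meet_le)
    then have "d \<sqinter> b = x"
      using covers_between[OF cov(2) m(1)] covers_incomparable[OF cov(2) d(1)] d by auto
    then show ?thesis
      using covers_between[OF w m(1)] m coversD(4)[OF cov(2)] by auto
  qed
  show "w = x"
  proof (rule ccontr)
    assume neq: "w \<noteq> x"
    have "\<not> w \<sqsubseteq> a" "\<not> w \<sqsubseteq> c" using le neq by blast+
    then have "f a < f w" "g c < g w"
      using le_iff[OF wD(1) inner_carrier(2)] le_iff[OF wD(1) inner_carrier(4)] wD(5,6) between inner_g
      by auto
    then have "x \<sqsubseteq> w"
      using le_iff[OF inner_carrier(1) wD(1)] coversD(5)[OF cov(1)] coversD(6)[OF cov(3)] by simp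
    then show False using covers_between[OF cov(2), of w] wD neq by auto
  qed
qed (use cov in simp)

end

section \<open>The boundary chains\<close>

lemma least_cover_exists:
  assumes "x \<in> carrier L" "x \<noteq> u"
  shows "\<exists>y. least_cover L f x y"
proof -
  have "{y. covers L x y} \<subseteq> carrier L" using coversD by blast
  then have fin: "finite {y. covers L x y}" using finite_carrier finite_subset by blast
  obtain y where "covers L x y" using cover_above[of x u] u assms by blast
  then have "{y. covers L x y} \<noteq> {}" by blast
  then obtain y where "covers L x y" "\<And>w. covers L x w \<Longrightarrow> f y \<le> f w"
    using arg_min_if_finite[OF fin, of f] by (force simp: not_less)
  then show ?thesis unfolding least_cover_def by blast
qed

text \<open>An inner cover has only one lower cover, so \<open>y\<close> would lie strictly between
  two covers of \<open>x\<close> itself.\<close>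

lemma least_cover_not_inner:
  assumes "least_cover L f x y"
  shows "\<not> inner_cover L f y"
proof
  assume "inner_cover L f y"
  then obtain w a c where w: "covers L w a" "covers L w y" "covers L w c" "f a < f y" "f y < f c"
    unfolding inner_cover_def by blast
  then have "x = w" using inner_lower_cover[OF w, of x] assms unfolding least_cover_def by blast
  then show False using assms w unfolding least_cover_def by force
qed

abbreviation left_chain :: "nat \<Rightarrow> 'a" where "left_chain \<equiv> boundary_chain L f z"

lemma left_chain_Suc:
  "least_cover L f (left_chain i) (left_chain (Suc i)) \<or> left_chain (Suc i) = left_chain i"
proof (cases "\<exists>y. least_cover L f (left_chain i) y")
  case True
  then show ?thesis using someI_ex[OF True] by (simp add: boundary_chain.simps(2))
qed (simp add: boundary_chain.simps(2))

lemma left_chain_covers_eq: "covers_eq L (left_chain i) (left_chain (Suc i))"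
  using left_chain_Suc[of i] unfolding covers_eq_def least_cover_def by metis

lemma left_chain_carrier: "left_chain i \<in> carrier L"
proof (induction i)
  case (Suc i)
  then show ?case
    using left_chain_Suc[of i] coversD(2)[of "left_chain i" "left_chain (Suc i)"]
    unfolding least_cover_def by metis
qed (simp add: z)

lemma left_chain_step:
  assumes "left_chain i \<noteq> u"
  shows "least_cover L f (left_chain i) (left_chain (Suc i))"
  using someI_ex[OF least_cover_exists[OF left_chain_carrier assms]]
    least_cover_exists[OF left_chain_carrier assms] by (simp add: boundary_chain.simps(2))

lemma left_chain_mono: "i \<le> j \<Longrightarrow> left_chain i \<sqsubseteq> left_chain j"
proof (induction j rule: dec_induct)
  case (step j)
  have "left_chain j \<sqsubseteq> left_chain (Suc j)"
    using left_chain_covers_eq[of j] le_refl[OF left_chain_carrier, of j]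
      coversD(3)[of "left_chain j" "left_chain (Suc j)"]
    unfolding covers_eq_def by metis
  from le_trans[OF step.IH this left_chain_carrier left_chain_carrier left_chain_carrier]
  show ?case .
qed (use left_chain_carrier in auto)

lemma left_chain_top_stays:
  assumes "left_chain i = u"
  shows "left_chain (Suc i) = u"
  using left_chain_mono[of i "Suc i"] u(2)[OF left_chain_carrier[of "Suc i"]] left_chain_carrier[of "Suc i"] u(1)
  unfolding assms by (intro le_antisym) simp_all

text \<open>This makes the chain a boundary: nothing is to its left. In the step, a counterexample
  \<open>y\<close> would be above \<open>left_chain i\<close>; a cover of
  \<open>left_chain i\<close> below \<open>y\<close> has \<open>f\<close> at least that of the
  leftmost cover, which forces \<open>y\<close> to be that cover.\<close>

lemma left_chain_boundary:
  "y \<in> carrier L \<Longrightarrow> f y \<le> f (left_chain i) \<Longrightarrow> y \<sqsubseteq> left_chain i"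
proof (induction i arbitrary: y)
  case 0
  then have "f z = f y" using le_iff[OF z(1) 0(1)] z(2)[OF 0(1)] by simp
  then have "y = z" using f_inj[OF z(1) 0(1)] by simp
  then show ?case using z by simp
next
  case (Suc i)
  show ?case
  proof (cases "left_chain i = u")
    case True
    then have "left_chain (Suc i) = u"
      by (rule left_chain_top_stays)
    then show ?thesis using u(2)[OF Suc.prems(1)] by simp
  next
    case False
    let ?c = "left_chain i" and ?d = "left_chain (Suc i)"
    have d: "covers L ?c ?d" and min: "\<And>w. covers L ?c w \<Longrightarrow> f ?d \<le> f w"
      using left_chain_step[OF False] unfolding least_cover_def by blast+
    note dD = coversD[OF d]
    show ?thesis
    proof (rule ccontr)
      assume n: "\<not> y \<sqsubseteq> ?d"
      then have g: "g ?d < g y" using le_iff[OF Suc.prems(1) dD(2)] Suc.prems(2) by auto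
      have "\<not> y \<sqsubseteq> ?c" using n le_trans[OF _ dD(3) Suc.prems(1) dD(1,2)] by blast
      then have "f ?c < f y" using Suc.IH[OF Suc.prems(1)] by force
      then have "?c \<sqsubseteq> y" "?c \<noteq> y" using le_iff[OF dD(1) Suc.prems(1)] g dD by auto
      then obtain w where w: "covers L ?c w" "w \<sqsubseteq> y"
        using cover_above[OF dD(1) Suc.prems(1)] by blast
      have "f ?d \<le> f y"
        using min[OF w(1)] le_iff[OF coversD(2)[OF w(1)] Suc.prems(1)] w(2) by simp
      then have "y = ?d" using f_inj[OF Suc.prems(1) dD(2)] Suc.prems(2) by simp
      then show False using n dD(2) by simp
    qed
  qed
qed

text \<open>A second cover with smaller \<open>f\<close> would lie below the chain element, but two
  covers of one element are incomparable.\<close>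

lemma left_chain_not_inner: "\<not> inner_cover L f (left_chain i)"
proof
  assume "inner_cover L f (left_chain i)"
  then obtain w a where w: "covers L w a" "covers L w (left_chain i)" "f a < f (left_chain i)"
    unfolding inner_cover_def by blast
  then show False
    using left_chain_boundary[OF coversD(2)[OF w(1)], of i] covers_incomparable[OF w(1,2)] by auto
qed

text \<open>Until \<open>u\<close> is reached each step enlarges the down-set, so that of
  \<open>left_chain i\<close> has more than \<open>i\<close> elements.\<close>

lemma left_chain_top: "left_chain (card (carrier L)) = u"
proof -
  let ?D = "\<lambda>x. {y \<in> carrier L. y \<sqsubseteq> x}"
  have fin: "finite (?D x)" for x using finite_carrier by simp
  have "left_chain i = u \<or> i < card (?D (left_chain i))" for i
  proof (induction i)
    case 0
    have "z \<in> ?D z" using z by auto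
    then show ?case using fin[of z] by (auto simp: card_gt_0_iff)
  next
    case (Suc i)
    show ?case
    proof (cases "left_chain i = u")
      case True
      then have "left_chain (Suc i) = u"
        by (rule left_chain_top_stays)
      then show ?thesis ..
    next
      case False
      then have c: "covers L (left_chain i) (left_chain (Suc i))"
        using left_chain_step unfolding least_cover_def by blast
      note cD = coversD[OF c]
      have "?D (left_chain i) \<subseteq> ?D (left_chain (Suc i))"
        using le_trans[OF _ cD(3) _ cD(1,2)] by blast
      moreover have "left_chain (Suc i) \<in> ?D (left_chain (Suc i))"
        using cD(2) by simp
      moreover have "left_chain (Suc i) \<notin> ?D (left_chain i)"
        using cD le_antisym[OF cD(3)] by blast
      ultimately have "?D (left_chain i) \<subset> ?D (left_chain (Suc i))" by blast
      from psubset_card_mono[OF fin this] show ?thesis using Suc False by simp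
    qed
  qed
  moreover have "card (?D x) \<le> card (carrier L)" for x
    using finite_carrier by (intro card_mono) auto
  ultimately show ?thesis by (metis linorder_not_less)
qed

lemma left_chain_last_below:
  assumes "x \<in> carrier L" "x \<noteq> u"
  obtains i where "i \<le> card (carrier L)" "left_chain i \<sqsubseteq> x" "\<not> left_chain (Suc i) \<sqsubseteq> x"
    "covers L (left_chain i) (left_chain (Suc i))"
proof -
  have "\<not> left_chain (card (carrier L)) \<sqsubseteq> x"
    using left_chain_top le_antisym[OF _ u(2)[OF assms(1)] u(1) assms(1)] assms(2) by auto
  moreover have "left_chain 0 \<sqsubseteq> x" using z assms by simp
  ultimately obtain i where i: "i < card (carrier L)" "left_chain i \<sqsubseteq> x" "\<not> left_chain (Suc i) \<sqsubseteq> x"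
    using ex_least_nat_less[of "\<lambda>i. \<not> left_chain i \<sqsubseteq> x"] by blast
  moreover have "left_chain i \<noteq> u"
    using i(2) le_antisym[OF _ u(2)[OF assms(1)] u(1) assms(1)] assms(2) by auto
  ultimately show thesis
    using that[of i] left_chain_step[of i] unfolding least_cover_def by simp
qed

abbreviation right_chain :: "nat \<Rightarrow> 'a" where "right_chain \<equiv> boundary_chain L g z"

lemmas right_chain_carrier = semimodular_realized.left_chain_carrier[OF swapped]
  and right_chain_covers_eq = semimodular_realized.left_chain_covers_eq[OF swapped]
  and right_chain_mono = semimodular_realized.left_chain_mono[OF swapped]
  and right_chain_boundary = semimodular_realized.left_chain_boundary[OF swapped]
  and right_chain_not_inner = semimodular_realized.left_chain_not_inner[OF swapped, unfolded inner_cover_swap]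
  and right_chain_top = semimodular_realized.left_chain_top[OF swapped]
  and right_chain_last_below = semimodular_realized.left_chain_last_below[OF swapped]

text \<open>
  If the largest \<open>c \<squnion> d \<sqsubseteq> x\<close> were a proper lower bound, then any \<open>w\<close> between would be a middle cover of
  it, lying between the joins with the next elements \<open>c'\<close> and \<open>d'\<close> of the two boundary chains, and the
  only upper cover of \<open>w\<close> would be above \<open>c'\<close>.
\<close>

lemma boundary_chains_generate:
  assumes x: "x \<in> carrier L" and not_inner: "\<not> inner_cover L f x"
  shows "\<exists>i\<le>card (carrier L). \<exists>j\<le>card (carrier L). left_chain i \<squnion> right_chain j = x"
proof (cases "x = u")
  case True
  have "u \<squnion> u = u" using u by (intro join_eqI) auto
  then show ?thesis
    using True left_chain_top right_chain_top by (intro exI[of _ "card (carrier L)"] conjI) simp_all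
next
  case False
  obtain i where i: "i \<le> card (carrier L)" "left_chain i \<sqsubseteq> x" "\<not> left_chain (Suc i) \<sqsubseteq> x"
    "covers L (left_chain i) (left_chain (Suc i))"
    using left_chain_last_below[OF x False] by blast
  obtain j where j: "j \<le> card (carrier L)" "right_chain j \<sqsubseteq> x" "\<not> right_chain (Suc j) \<sqsubseteq> x"
    "covers L (right_chain j) (right_chain (Suc j))"
    using right_chain_last_below[OF x False] by blast
  define c d c' d' where "c = left_chain i" and "d = right_chain j"
    and "c' = left_chain (Suc i)" and "d' = right_chain (Suc j)"
  define y where "y = c \<squnion> d"
  have c: "c \<sqsubseteq> x" "\<not> c' \<sqsubseteq> x" "covers L c c'" and d: "d \<sqsubseteq> x" "\<not> d' \<sqsubseteq> x" "covers L d d'"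
    using i j unfolding c_def d_def c'_def d'_def by auto
  have bc: "w \<sqsubseteq> c'" if "w \<in> carrier L" "f w \<le> f c'" for w
    using left_chain_boundary that unfolding c'_def by blast
  have bd: "w \<sqsubseteq> d'" if "w \<in> carrier L" "g w \<le> g d'" for w
    using right_chain_boundary that unfolding d'_def by blast
  note cD = coversD[OF c(3)] and dD = coversD[OF d(3)]
  have y: "y \<in> carrier L" "c \<sqsubseteq> y" "d \<sqsubseteq> y" "y \<sqsubseteq> x"
    unfolding y_def using cD dD c d x by (auto simp: join_left join_right join_le)
  have "y = x"
  proof (rule ccontr)
    assume "y \<noteq> x"
    then obtain w where w: "covers L y w" "w \<sqsubseteq> x" using cover_above[of y x] y x by blast
    note wD = coversD[OF w(1)]
    \<comment> \<open>As \<open>e\<close> is strictly below \<open>w\<close>, a \<open>w\<close>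
      below the cover \<open>e'\<close> of \<open>e\<close> equals \<open>e'\<close>. Since
      \<open>c'\<close> and \<open>d'\<close> are not below \<open>x\<close>, this keeps
      \<open>w\<close> from being below either of them.\<close>
    have next_below: "w \<sqsubseteq> e' \<longrightarrow> e' \<sqsubseteq> x" if e: "covers L e e'" "e \<sqsubseteq> y" for e e'
    proof
      assume le: "w \<sqsubseteq> e'"
      have "e \<sqsubseteq> w" "e \<noteq> w" using e y wD le_trans[of e y w] le_antisym[of e y] coversD[OF e(1)] by auto
      then have "w = e'" using covers_between[OF e(1) wD(2)] le by blast
      then show "e' \<sqsubseteq> x" using w by simp
    qed
    have nw: "\<not> w \<sqsubseteq> c'" "\<not> w \<sqsubseteq> d'" "\<not> c' \<sqsubseteq> w" "\<not> d' \<sqsubseteq> w"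
      using next_below c d y w wD x cD dD le_trans[of c' w x] le_trans[of d' w x] by blast+
    \<comment> \<open>By the boundary property and the incomparabilities just shown, this and the
      next fact place \<open>w\<close> to the right of \<open>c'\<close> and to the left of
      \<open>d'\<close>.\<close>
    have fg: "f c' < f w" "g d' < g w" using nw bc[of w] bd[of w] wD by force+
    have fg': "g w < g c'" "f w < f d'"
      using nw fg le_iff[of c' w] le_iff[of d' w] wD cD dD by force+
    have ny: "\<not> c' \<sqsubseteq> y" "\<not> d' \<sqsubseteq> y"
      using c d y x cD dD le_trans[of c' y x] le_trans[of d' y x] by blast+
    have a: "covers L y (c' \<squnion> y)" and b: "covers L y (d' \<squnion> y)"
      using covers_join_absorb c d y ny by blast+
    have le: "c' \<sqsubseteq> c' \<squnion> y" "d' \<sqsubseteq> d' \<squnion> y" using y cD dD by (auto simp: join_left)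
    then have "g w < g (c' \<squnion> y)" "f w < f (d' \<squnion> y)"
      using fg' le_iff cD dD coversD[OF a] coversD[OF b] by force+
    then have lt: "f (c' \<squnion> y) < f w" "f w < f (d' \<squnion> y)"
      using covers_f_less_iff[OF a w(1)] by auto
    \<comment> \<open>\<open>w\<close> is now an inner cover of \<open>y\<close> and
      \<open>x\<close> is not inner; hence the only upper cover of \<open>w\<close> is still below
      \<open>x\<close>.\<close>
    then have "w \<noteq> x" using a w(1) b not_inner unfolding inner_cover_def by blast
    then obtain v where v: "covers L w v" "v \<sqsubseteq> x" using cover_above[of w x] wD x w by blast
    then have "v = (c' \<squnion> y) \<squnion> (d' \<squnion> y)" using inner_upper_cover[OF a w(1) b lt] by blast
    then have "c' \<squnion> y \<sqsubseteq> v" using coversD[OF a] coversD[OF b] by (simp add: join_left)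
    then have "c' \<sqsubseteq> x"
      using le_trans[of c' "c' \<squnion> y" v] le_trans[of c' v x] le v coversD[OF a] coversD[OF v(1)] cD x
      by blast
    then show False using c by blast
  qed
  then show ?thesis using i j unfolding y_def c_def d_def by blast
qed

end

section \<open>The three steps\<close>

lemma grid_simps:
  "carrier (grid m n) = {0..m} \<times> {0..n}"
  "(a, b) \<sqsubseteq>\<^bsub>grid m n\<^esub> (c, d) \<longleftrightarrow> a \<le> c \<and> b \<le> d"
  "eq (grid m n) = (=)"
  by (simp_all add: grid_def)

lemma partial_order_grid: "partial_order (grid m n)"
  by unfold_locales (auto simp: grid_simps)

lemma lattice_grid: "lattice (grid m n)"
  and join_grid: "\<lbrakk>a \<le> m; c \<le> m; b \<le> n; d \<le> n\<rbrakk> \<Longrightarrow>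
    (a, b) \<squnion>\<^bsub>grid m n\<^esub> (c, d) = (max a c, max b d)"
  and meet_grid: "\<lbrakk>a \<le> m; c \<le> m; b \<le> n; d \<le> n\<rbrakk> \<Longrightarrow>
    (a, b) \<sqinter>\<^bsub>grid m n\<^esub> (c, d) = (min a c, min b d)"
proof -
  interpret partial_order "grid m n" by (rule partial_order_grid)
  show "lattice (grid m n)"
  proof (rule latticeI)
    fix x y assume "x \<in> carrier (grid m n)" "y \<in> carrier (grid m n)"
    then show "\<exists>s\<in>carrier (grid m n). x \<sqsubseteq>\<^bsub>grid m n\<^esub> s \<and> y \<sqsubseteq>\<^bsub>grid m n\<^esub> s \<and>
        (\<forall>w\<in>carrier (grid m n). x \<sqsubseteq>\<^bsub>grid m n\<^esub> w \<longrightarrow> y \<sqsubseteq>\<^bsub>grid m n\<^esub> w \<longrightarrow> s \<sqsubseteq>\<^bsub>grid m n\<^esub> w)"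
      by (intro bexI[of _ "(max (fst x) (fst y), max (snd x) (snd y))"]) (auto simp: grid_simps)
  next
    fix x y assume "x \<in> carrier (grid m n)" "y \<in> carrier (grid m n)"
    then show "\<exists>s\<in>carrier (grid m n). s \<sqsubseteq>\<^bsub>grid m n\<^esub> x \<and> s \<sqsubseteq>\<^bsub>grid m n\<^esub> y \<and>
        (\<forall>w\<in>carrier (grid m n). w \<sqsubseteq>\<^bsub>grid m n\<^esub> x \<longrightarrow> w \<sqsubseteq>\<^bsub>grid m n\<^esub> y \<longrightarrow> w \<sqsubseteq>\<^bsub>grid m n\<^esub> s)"
      by (intro bexI[of _ "(min (fst x) (fst y), min (snd x) (snd y))"]) (auto simp: grid_simps)
  qed
  show "(a, b) \<squnion>\<^bsub>grid m n\<^esub> (c, d) = (max a c, max b d)" if "a \<le> m" "c \<le> m" "b \<le> n" "d \<le> n"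
    using that by (intro join_eqI) (auto simp: grid_simps)
  show "(a, b) \<sqinter>\<^bsub>grid m n\<^esub> (c, d) = (min a c, min b d)" if "a \<le> m" "c \<le> m" "b \<le> n" "d \<le> n"
    using that by (intro meet_eqI) (auto simp: grid_simps)
qed

lemma planar_lattice_grid: "planar_lattice (grid m n)"
  unfolding planar_lattice_def finite_lattice_def
  by (intro conjI exI[of _ grid_pos] lattice_grid planar_diagram_grid) (simp_all add: grid_simps)

lemma distributive_grid: "distributive (grid m n)"
  unfolding distributive_def
  by (auto simp: grid_simps join_grid meet_grid max_def min_def)

lemma covers_restrict_to:
  fixes P :: "'a gorder"
  assumes "covers P x y" "S \<subseteq> carrier P" "x \<in> S" "y \<in> S"
  shows "covers (restrict_to P S) x y"
  using assms unfolding covers_def restrict_to_def lless_def by auto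

section \<open>The sublattice without inner covers\<close>

context semimodular_realized
begin

definition skeleton :: "'a set" where
  "skeleton = {x \<in> carrier L. \<not> inner_cover L f x}"

lemma skeleton_subset: "skeleton \<subseteq> carrier L"
  unfolding skeleton_def by blast

text \<open>An inner join would have a single lower cover. Not being inner, \<open>x\<close> and
  \<open>y\<close> differ from the join, so both are below that lower cover, and then so is their
  join.\<close>

lemma skeleton_join:
  assumes "x \<in> skeleton" "y \<in> skeleton"
  shows "x \<squnion> y \<in> skeleton"
proof -
  have c: "x \<in> carrier L" "y \<in> carrier L" "x \<squnion> y \<in> carrier L"
    using assms skeleton_subset join_closed[of x y] by blast+
  have "\<not> inner_cover L f (x \<squnion> y)"
  proof
    assume inner: "inner_cover L f (x \<squnion> y)"
    then obtain w a b where w: "covers L w a" "covers L w (x \<squnion> y)" "covers L w b"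
        "f a < f (x \<squnion> y)" "f (x \<squnion> y) < f b"
      unfolding inner_cover_def by blast
    have "v \<sqsubseteq> w" if v: "v \<in> skeleton" "v \<sqsubseteq> x \<squnion> y" for v
    proof -
      have "v \<noteq> x \<squnion> y" using v inner unfolding skeleton_def by blast
      then obtain t where "covers L t (x \<squnion> y)" "v \<sqsubseteq> t"
        using cover_below[of v "x \<squnion> y"] v c(3) skeleton_subset by blast
      then show ?thesis using inner_lower_cover[OF w] by simp
    qed
    then have "x \<squnion> y \<sqsubseteq> w" using assms c coversD[OF w(1)] by (simp add: join_le join_left join_right)
    then show False using coversD[OF w(2)] le_antisym[of w "x \<squnion> y"] by blast
  qed
  then show ?thesis using c unfolding skeleton_def by blast
qed

text \<open>The dual argument, with the single upper cover.\<close>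

lemma skeleton_meet:
  assumes "x \<in> skeleton" "y \<in> skeleton"
  shows "x \<sqinter> y \<in> skeleton"
proof -
  have c: "x \<in> carrier L" "y \<in> carrier L" "x \<sqinter> y \<in> carrier L"
    using assms skeleton_subset meet_closed[of x y] by blast+
  have "\<not> inner_cover L f (x \<sqinter> y)"
  proof
    assume inner: "inner_cover L f (x \<sqinter> y)"
    then obtain w a b where w: "covers L w a" "covers L w (x \<sqinter> y)" "covers L w b"
        "f a < f (x \<sqinter> y)" "f (x \<sqinter> y) < f b"
      unfolding inner_cover_def by blast
    have cov: "covers L (x \<sqinter> y) (a \<squnion> b)" using inner_upper_cover[OF w] by blast
    have "a \<squnion> b \<sqsubseteq> v" if v: "v \<in> skeleton" "x \<sqinter> y \<sqsubseteq> v" for v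
    proof -
      have "x \<sqinter> y \<noteq> v" using v inner unfolding skeleton_def by blast
      then obtain t where "covers L (x \<sqinter> y) t" "t \<sqsubseteq> v"
        using cover_above[of "x \<sqinter> y" v] v c(3) skeleton_subset by blast
      then show ?thesis using inner_upper_cover[OF w] by simp
    qed
    then have "a \<squnion> b \<sqsubseteq> x \<sqinter> y" using assms c coversD[OF cov] by (simp add: meet_le meet_left meet_right)
    then show False using coversD[OF cov] le_antisym[of "x \<sqinter> y" "a \<squnion> b"] by blast
  qed
  then show ?thesis using c unfolding skeleton_def by blast
qed

abbreviation M :: "'a gorder" where "M \<equiv> restrict_to L skeleton"

lemma lattice_M: "lattice M"
  and join_M: "x \<in> skeleton \<Longrightarrow> y \<in> skeleton \<Longrightarrow> x \<squnion>\<^bsub>M\<^esub> y = x \<squnion> y"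
proof -
  have M: "carrier M = skeleton" "x \<sqsubseteq>\<^bsub>M\<^esub> y \<longleftrightarrow> x \<sqsubseteq> y" for x y
    by (simp_all add: restrict_to_def)
  note e = lattice_embedded[of L M "\<lambda>x. x", OF lattice_axioms
      partial_order_restrict_to[OF partial_order_axioms skeleton_subset]]
  show "lattice M"
    using skeleton_subset skeleton_join skeleton_meet by (intro e(1)) (auto simp: M)
  show "x \<squnion>\<^bsub>M\<^esub> y = x \<squnion> y" if "x \<in> skeleton" "y \<in> skeleton"
    using skeleton_subset skeleton_join skeleton_meet that by (intro e(2)) (auto simp: M)
qed

lemma finite_lattice_M: "finite_lattice M"
proof -
  have "z \<in> skeleton"
    using left_chain_not_inner[of 0] z unfolding skeleton_def by simp
  then show ?thesis
    using lattice_M finite_subset[OF skeleton_subset finite_carrier]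
    unfolding finite_lattice_def by (auto simp: restrict_to_def)
qed

lemma planar_diagram_M: "planar_diagram M (dominance_pos f g)"
proof (rule planar_diagram_dominance[OF lattice_M])
  have c: "x \<in> carrier L" if "x \<in> skeleton" for x using that skeleton_subset by blast
  show "realizer M f g"
    unfolding realizer_def inj_on_def restrict_to_def
    using f_inj[OF c c] g_inj[OF c c] le_iff[OF c c] by simp
qed

section \<open>The map from the grid\<close>

abbreviation grid_map :: "nat \<times> nat \<Rightarrow> 'a" where
  "grid_map \<equiv> \<lambda>(i, j). left_chain i \<squnion> right_chain j"

lemma chains_in_skeleton: "left_chain i \<in> skeleton" "right_chain j \<in> skeleton"
  unfolding skeleton_def
  using left_chain_carrier right_chain_carrier left_chain_not_inner right_chain_not_inner by auto

lemma grid_map_in_skeleton: "grid_map p \<in> skeleton"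
  by (cases p) (simp add: skeleton_join chains_in_skeleton)

lemma grid_map_join:
  "grid_map (i, j) \<squnion> grid_map (k, l) = grid_map (max i k, max j l)"
proof -
  note c = left_chain_carrier right_chain_carrier
  have mono: "left_chain i \<sqsubseteq> left_chain (max i k)" "left_chain k \<sqsubseteq> left_chain (max i k)"
    "right_chain j \<sqsubseteq> right_chain (max j l)" "right_chain l \<sqsubseteq> right_chain (max j l)" for i k j l
    using left_chain_mono right_chain_mono by simp_all
  have le: "x \<squnion> y \<sqsubseteq> x' \<squnion> y'" if "x \<in> carrier L" "y \<in> carrier L" "x' \<in> carrier L" "y' \<in> carrier L"
      "x \<sqsubseteq> x'" "y \<sqsubseteq> y'" for x y x' y'
    using that le_trans[of x x' "x' \<squnion> y'"] le_trans[of y y' "x' \<squnion> y'"]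
    by (simp add: join_le join_left join_right)
  show ?thesis
  proof (simp, intro join_eqI)
    fix w assume w: "w \<in> carrier L" "left_chain i \<squnion> right_chain j \<sqsubseteq> w" "left_chain k \<squnion> right_chain l \<sqsubseteq> w"
    then have "left_chain i \<sqsubseteq> w" "right_chain j \<sqsubseteq> w" "left_chain k \<sqsubseteq> w" "right_chain l \<sqsubseteq> w"
      using c le_trans join_left join_right join_closed by meson+
    then have "left_chain (max i k) \<sqsubseteq> w" "right_chain (max j l) \<sqsubseteq> w" by (simp_all add: max_def)
    then show "left_chain (max i k) \<squnion> right_chain (max j l) \<sqsubseteq> w" using w c by (simp add: join_le)
  qed (use c mono le in simp_all)
qed

lemma grid_map_image:
  "grid_map ` carrier (grid (card (carrier L)) (card (carrier L))) = skeleton"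
proof
  show "grid_map ` carrier (grid (card (carrier L)) (card (carrier L))) \<subseteq> skeleton"
    using grid_map_in_skeleton by blast
  show "skeleton \<subseteq> grid_map ` carrier (grid (card (carrier L)) (card (carrier L)))"
  proof
    fix x assume "x \<in> skeleton"
    then obtain i j where "i \<le> card (carrier L)" "j \<le> card (carrier L)" "x = grid_map (i, j)"
      using boundary_chains_generate[of x] unfolding skeleton_def by auto
    then show "x \<in> grid_map ` carrier (grid (card (carrier L)) (card (carrier L)))"
      by (auto simp: grid_simps)
  qed
qed

text \<open>An edge of the grid changes one coordinate by one, so the two images are joins of a
  fixed element with consecutive elements of a boundary chain.\<close>

lemma grid_map_hom: "cover_preserving_join_hom (grid m n) M grid_map"
  unfolding cover_preserving_join_hom_def join_pres_def
proof (intro conjI ballI allI impI)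
  show "grid_map \<in> carrier (grid m n) \<rightarrow> carrier M"
    using grid_map_in_skeleton by (auto simp: restrict_to_def)
next
  fix x y assume xy: "x \<in> carrier (grid m n)" "y \<in> carrier (grid m n)"
  obtain i j k l where p: "x = (i, j)" "y = (k, l)" by fastforce
  have "grid_map (x \<squnion>\<^bsub>grid m n\<^esub> y) = grid_map (max i k, max j l)"
    using xy unfolding p by (simp add: join_grid grid_simps)
  also have "\<dots> = grid_map x \<squnion>\<^bsub>M\<^esub> grid_map y"
    unfolding join_M[OF grid_map_in_skeleton grid_map_in_skeleton] unfolding p grid_map_join ..
  finally show "grid_map (x \<squnion>\<^bsub>grid m n\<^esub> y) = grid_map x \<squnion>\<^bsub>M\<^esub> grid_map y" .
next
  fix x y assume xy: "covers (grid m n) x y \<and> grid_map x \<noteq> grid_map y"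
  obtain i j k l where p: "x = (i, j)" "y = (k, l)" by fastforce
  have "k = Suc i \<and> l = j \<or> k = i \<and> l = Suc j"
    using xy unfolding p grid_covers by blast
  then have "covers_eq L (grid_map x) (grid_map y)"
  proof
    assume "k = Suc i \<and> l = j"
    then show ?thesis
      using covers_eq_join[OF left_chain_covers_eq left_chain_carrier right_chain_carrier]
      unfolding p by simp
  next
    assume "k = i \<and> l = Suc j"
    then show ?thesis
      using covers_eq_join[OF right_chain_covers_eq right_chain_carrier left_chain_carrier]
      unfolding p by (simp add: join_comm[of L "left_chain i"])
  qed
  then have "covers L (grid_map x) (grid_map y)" using xy unfolding covers_eq_def by blast
  then show "covers M (grid_map x) (grid_map y)"
    by (rule covers_restrict_to[OF _ skeleton_subset grid_map_in_skeleton grid_map_in_skeleton])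
qed (use lattice_grid lattice_M in auto)

text \<open>The bottom \<open>x\<close> has two upper covers and the top two lower covers, so
  neither is inner, and \<open>a\<close>, \<open>b\<close> are extreme covers. An element of
  \<open>L\<close> inside the cell would be a cover of \<open>x\<close> between \<open>a\<close> and
  \<open>b\<close>, and those have been deleted.\<close>

lemma four_cell_M:
  assumes a: "least_cover L f x a" and b: "least_cover L g x b" and less: "f a < f b"
  shows "four_cell M (dominance_pos f g) (x, a, b, a \<squnion> b)"
proof -
  have ca: "covers L x a" and cb: "covers L x b"
    using a b unfolding least_cover_def by auto
  note aD = coversD[OF ca] and bD = coversD[OF cb]
  have ab: "a \<noteq> b" "f a < f b" "g b < g a" using less covers_f_less_iff[OF ca cb] by auto
  have av: "covers L a (a \<squnion> b)" and bv: "covers L b (a \<squnion> b)" using covers_join ca cb ab by blast+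
  have "\<not> inner_cover L f x"
  proof
    assume "inner_cover L f x"
    then obtain y c d where y: "covers L y c" "covers L y x" "covers L y d" "f c < f x" "f x < f d"
      unfolding inner_cover_def by blast
    have "a = b" using inner_upper_cover[OF y, of a] inner_upper_cover[OF y, of b] ca cb by simp
    then show False using ab by blast
  qed
  moreover have "\<not> inner_cover L f (a \<squnion> b)"
  proof
    assume "inner_cover L f (a \<squnion> b)"
    then obtain y c d where y: "covers L y c" "covers L y (a \<squnion> b)" "covers L y d"
        "f c < f (a \<squnion> b)" "f (a \<squnion> b) < f d"
      unfolding inner_cover_def by blast
    have "a = b" using inner_lower_cover[OF y, of a] inner_lower_cover[OF y, of b] av bv by simp
    then show False using ab by blast
  qed
  moreover have "\<not> inner_cover L f a" using least_cover_not_inner[OF a] .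
  moreover have "\<not> inner_cover L f b"
    using semimodular_realized.least_cover_not_inner[OF swapped b] inner_cover_swap by blast
  ultimately have S: "x \<in> skeleton" "a \<in> skeleton" "b \<in> skeleton" "a \<squnion> b \<in> skeleton"
    unfolding skeleton_def using aD bD by auto
  have covM: "covers M x a" "covers M a (a \<squnion> b)" "covers M x b" "covers M b (a \<squnion> b)"
    using covers_restrict_to[OF _ skeleton_subset] ca cb av bv S by blast+
  have lo: "left_of (chain_path (dominance_pos f g) x a (a \<squnion> b)) (chain_path (dominance_pos f g) x b (a \<squnion> b))"
    using coversD[OF av] coversD[OF bv] aD bD ab by (intro left_of_dominance_cell) auto
  have empty: "dominance_pos f g y \<notin> inside (chain_path (dominance_pos f g) x a (a \<squnion> b) \<union>
      chain_path (dominance_pos f g) x b (a \<squnion> b))" if y: "y \<in> skeleton" for y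
  proof
    assume i: "dominance_pos f g y \<in> inside (chain_path (dominance_pos f g) x a (a \<squnion> b) \<union>
      chain_path (dominance_pos f g) x b (a \<squnion> b))"
    have yc: "y \<in> carrier L" using y skeleton_subset by blast
    have "f x \<le> f y \<and> f y \<le> f (a \<squnion> b) \<and> g x \<le> g y \<and> g y \<le> g (a \<squnion> b) \<and> y \<noteq> x \<and> y \<noteq> a \<and> y \<noteq> b \<and> y \<noteq> a \<squnion> b"
      using coversD[OF av] coversD[OF bv] aD bD by (intro inside_dominance_cell[OF _ _ _ _ _ _ _ _ i]) auto
    then have yb: "x \<sqsubseteq> y" "y \<sqsubseteq> a \<squnion> b" "y \<noteq> x" "y \<noteq> a" "y \<noteq> b" "y \<noteq> a \<squnion> b"
      using le_iff yc aD coversD[OF av] by auto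
    obtain t where t: "covers L x t" "t \<sqsubseteq> y" using cover_above[of x y] aD yc yb by blast
    note tD = coversD[OF t(1)]
    \<comment> \<open>Every cover of \<open>x\<close> in the interval up to
      \<open>a \<squnion> b\<close> is covered by \<open>a \<squnion> b\<close>, so \<open>y\<close>
      is itself a cover of \<open>x\<close>.\<close>
    have tv: "covers L t (a \<squnion> b)"
    proof (cases "t = a")
      case False
      have "t \<sqsubseteq> a \<squnion> b" using le_trans[OF t(2) yb(2)] tD yc coversD[OF av] by blast
      then have "a \<squnion> t = a \<squnion> b" using join_covers_eqI[OF ca t(1) False[symmetric] av] by blast
      then show ?thesis using covers_join(2)[OF ca t(1) False[symmetric]] by simp
    qed (use av in simp)
    have "y = t" using covers_between[OF tv yc t(2) yb(2)] yb by blast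
    then have cy: "covers L x y" using t by simp
    have "f a \<le> f y" "g b \<le> g y" using a b cy unfolding least_cover_def by auto
    moreover have "f a \<noteq> f y" "g b \<noteq> g y"
      using f_inj[OF aD(2) yc] g_inj[OF bD(2) yc] yb by blast+
    ultimately have "f a < f y" "g b < g y" by simp_all
    then have "f y < f b" using covers_f_less_iff[OF cy cb] by blast
    then have "inner_cover L f y" using ca cy cb \<open>f a < f y\<close> unfolding inner_cover_def by blast
    then show False using y unfolding skeleton_def by blast
  qed
  show ?thesis
    unfolding four_cell_def using covM ab lo empty by (auto simp: restrict_to_def)
qed

lemma adds_to_four_cells_M: "adds_to_four_cells M (dominance_pos f g) L"
proof -
  have carM: "carrier M = skeleton" by (simp add: restrict_to_def)
  have ex: "\<exists>c. four_cell M (dominance_pos f g) c \<and>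
      (case c of (v, a, b, t) \<Rightarrow> {y. covers L y w} = {v} \<and> {y. covers L w y} = {t})"
    if wR: "w \<in> carrier L - skeleton" for w
  proof -
    obtain x a' b' where w: "covers L x a'" "covers L x w" "covers L x b'" "f a' < f w" "f w < f b'"
      using wR unfolding skeleton_def inner_cover_def by blast
    have x: "x \<in> carrier L" "x \<noteq> u"
      using coversD[OF w(1)] u(2)[of a'] le_antisym[of x a'] by blast+
    \<comment> \<open>The witnesses \<open>a'\<close> and \<open>b'\<close> may be inner themselves.
      The extreme covers of \<open>x\<close> are not, and \<open>w\<close> lies between them as
      well.\<close>
    obtain a b where a: "least_cover L f x a" and b: "least_cover L g x b"
      using least_cover_exists[OF x] semimodular_realized.least_cover_exists[OF swapped x] by blast
    have ca: "covers L x a" and cb: "covers L x b" using a b unfolding least_cover_def by auto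
    have "f a \<le> f a'" "g b \<le> g b'" using a b w(1,3) unfolding least_cover_def by blast+
    then have "f a < f w" "g b < g w" using covers_f_less_iff[OF w(2,3)] w(4,5) by auto
    then have lt: "f a < f w" "f w < f b" using covers_f_less_iff[OF w(2) cb] by blast+
    show ?thesis
      using four_cell_M[OF a b less_trans[OF lt]] inner_upper_cover[OF ca w(2) cb lt]
        inner_lower_cover[OF ca w(2) cb lt]
      by (intro exI[of _ "(x, a, b, a \<squnion> b)"]) auto
  qed
  then obtain q where q: "\<And>w. w \<in> carrier L - skeleton \<Longrightarrow> four_cell M (dominance_pos f g) (q w) \<and>
      (case q w of (v, a, b, t) \<Rightarrow> {y. covers L y w} = {v} \<and> {y. covers L w y} = {t})"
    by metis
  \<comment> \<open>Elements put into one cell cover the same element.\<close>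
  have "\<not> x \<sqsubseteq> y" if "x \<in> carrier L - skeleton" "y \<in> carrier L - skeleton" "q x = q y" "x \<noteq> y" for x y
  proof -
    obtain v a b t where c: "q x = (v, a, b, t)" by (metis surj_pair)
    have "{y. covers L y x} = {v}" using q[OF that(1)] c by simp
    moreover have "{x. covers L x y} = {v}" using q[OF that(2)] c that(3) by simp
    ultimately have "covers L v x" "covers L v y" by auto
    then show ?thesis using covers_incomparable that(4) by blast
  qed
  then show ?thesis
    unfolding adds_to_four_cells_def carM
    using partial_order_axioms skeleton_subset finite_carrier q
    by (intro conjI exI[of _ q]) (auto simp: restrict_to_def)
qed

end

section \<open>Assembling the decomposition\<close>

lemma realized_decomposition:
  fixes L :: "'a gorder"
  assumes L: "finite_lattice L" "semimodular L" "realizer L f g"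
  shows "\<exists>m n D K \<phi> M pos. D = restrict_to (grid m n) (carrier (grid m n)) \<and>
    planar_lattice D \<and> distributive D \<and> finite_lattice K \<and> cover_preserving_join_hom D K \<phi> \<and>
    M = restrict_to K (\<phi> ` carrier D) \<and> planar_lattice M \<and> planar_diagram M pos \<and>
    adds_to_four_cells M pos L"
proof -
  interpret lattice L using L unfolding finite_lattice_def by blast
  have fin: "finite (carrier L)" "carrier L \<noteq> {}" using L unfolding finite_lattice_def by auto
  obtain z u where "z \<in> carrier L" "u \<in> carrier L"
    "\<And>x. x \<in> carrier L \<Longrightarrow> z \<sqsubseteq>\<^bsub>L\<^esub> x" "\<And>x. x \<in> carrier L \<Longrightarrow> x \<sqsubseteq>\<^bsub>L\<^esub> u"
    using finite_bounds[OF fin] by blast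
  then interpret semimodular_realized L f g z u
    using L fin by unfold_locales auto
  let ?n = "card (carrier L)"
  let ?D = "grid ?n ?n"
  have D: "restrict_to ?D (carrier ?D) = ?D" by (simp add: restrict_to_def grid_def)
  \<comment> \<open>The map is onto, so \<open>M\<close> serves both as the codomain
    \<open>K\<close> and as the image.\<close>
  have M: "M = restrict_to M (grid_map ` carrier ?D)"
    unfolding grid_map_image by (simp add: restrict_to_def)
  have pM: "planar_lattice M"
    unfolding planar_lattice_def using finite_lattice_M planar_diagram_M by blast
  show ?thesis
    by (intro exI[of _ ?n] exI[of _ ?D] exI[of _ M] exI[of _ grid_map] exI[of _ "dominance_pos f g"]
        conjI D[symmetric] M pM planar_lattice_grid distributive_grid finite_lattice_M grid_map_hom
        planar_diagram_M adds_to_four_cells_M)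
qed

text \<open>In the theorem \<open>K\<close> and \<open>N\<close> live on \<open>nat\<close>, because
  an existential statement of HOL cannot choose a type. \<open>M\<close> is a part of both, so
  \<open>L\<close> is copied before it is decomposed, together with its two linear orders.\<close>

lemma finite_lattice_nat_copy:
  fixes L :: "'a gorder"
  assumes L: "finite_lattice L" "semimodular L" "realizer L f g"
  obtains N :: "nat gorder" and f' g' where "finite_lattice N" "semimodular N" "realizer N f' g'"
    "order_isomorphic N L"
proof -
  interpret lattice L using L unfolding finite_lattice_def by blast
  have fin: "finite (carrier L)" "carrier L \<noteq> {}" using L unfolding finite_lattice_def by auto
  obtain e :: "'a \<Rightarrow> nat" where e: "inj_on e (carrier L)"
    using finite_imp_inj_to_nat_seg[OF fin(1)] by blast
  define h where "h = inv_into (carrier L) e"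
  define N :: "nat gorder" where
    "N = \<lparr>carrier = e ` carrier L, eq = (=), le = (\<lambda>i j. h i \<sqsubseteq>\<^bsub>L\<^esub> h j)\<rparr>"
  have N: "carrier N = e ` carrier L" "i \<sqsubseteq>\<^bsub>N\<^esub> j \<longleftrightarrow> h i \<sqsubseteq>\<^bsub>L\<^esub> h j" "eq N = (=)" for i j
    by (simp_all add: N_def)
  have bij: "bij_betw h (carrier N) (carrier L)"
    using e unfolding h_def N by (simp add: bij_betw_inv_into inj_on_imp_bij_betw)
  then have h: "h ` carrier N = carrier L" "inj_on h (carrier N)" unfolding bij_betw_def by auto
  have hc: "h i \<in> carrier L" if "i \<in> carrier N" for i using h that by blast
  have h_eq: "i = j" if "i \<in> carrier N" "j \<in> carrier N" "h i = h j" for i j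
    using h(2) that by (simp add: inj_on_def)
  have poN: "partial_order N"
  proof unfold_locales
    fix i j assume "i \<sqsubseteq>\<^bsub>N\<^esub> j" "j \<sqsubseteq>\<^bsub>N\<^esub> i" "i \<in> carrier N" "j \<in> carrier N"
    then show "i .=\<^bsub>N\<^esub> j" using h_eq[of i j] hc[of i] hc[of j] le_antisym unfolding N(2,3) by blast
  next
    fix i j k assume "i \<sqsubseteq>\<^bsub>N\<^esub> j" "j \<sqsubseteq>\<^bsub>N\<^esub> k" "i \<in> carrier N" "j \<in> carrier N" "k \<in> carrier N"
    then show "i \<sqsubseteq>\<^bsub>N\<^esub> k" using hc[of i] hc[of j] hc[of k] le_trans unfolding N(2) by blast
  qed (use hc in \<open>auto simp: N(2,3)\<close>)
  interpret N: partial_order N by (fact poN)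
  have join: "h i \<squnion>\<^bsub>L\<^esub> h j \<in> h ` carrier N" "h i \<sqinter>\<^bsub>L\<^esub> h j \<in> h ` carrier N"
    if "i \<in> carrier N" "j \<in> carrier N" for i j
    using that hc unfolding h(1) by auto
  have hN: "h \<in> carrier N \<rightarrow> carrier L" using hc by blast
  note emb = lattice_embedded[OF lattice_axioms poN hN N(2)[symmetric] join]
  have latN: "lattice N" by (rule emb(1))
  have h_join: "h (i \<squnion>\<^bsub>N\<^esub> j) = h i \<squnion>\<^bsub>L\<^esub> h j" if "i \<in> carrier N" "j \<in> carrier N" for i j
    using emb(2) that by blast
  interpret N: lattice N by (fact latN)
  have "finite_lattice N" unfolding finite_lattice_def using latN fin N(1) by simp
  moreover have cov: "covers N i j \<longleftrightarrow> covers L (h i) (h j)"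
    if "i \<in> carrier N" "j \<in> carrier N" for i j
  proof -
    have less: "k \<sqsubset>\<^bsub>N\<^esub> l \<longleftrightarrow> h k \<sqsubset>\<^bsub>L\<^esub> h l" if "k \<in> carrier N" "l \<in> carrier N" for k l
      unfolding lless_eq N.lless_eq N(2) using h_eq that by blast
    have "(\<exists>k\<in>carrier N. i \<sqsubset>\<^bsub>N\<^esub> k \<and> k \<sqsubset>\<^bsub>N\<^esub> j) \<longleftrightarrow>
        (\<exists>k\<in>carrier N. h i \<sqsubset>\<^bsub>L\<^esub> h k \<and> h k \<sqsubset>\<^bsub>L\<^esub> h j)"
      using less that by (intro bex_cong) simp_all
    also have "\<dots> \<longleftrightarrow> (\<exists>x\<in>carrier L. h i \<sqsubset>\<^bsub>L\<^esub> x \<and> x \<sqsubset>\<^bsub>L\<^esub> h j)"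
      unfolding h(1)[symmetric] by blast
    finally show ?thesis
      using that hc[OF that(1)] hc[OF that(2)] less[OF that] unfolding covers_def by simp
  qed
  have "semimodular N"
    unfolding semimodular_def
  proof (intro ballI impI)
    fix a b c assume c: "a \<in> carrier N" "b \<in> carrier N" "c \<in> carrier N" and ab: "covers N a b"
    have j: "a \<squnion>\<^bsub>N\<^esub> c \<in> carrier N" "b \<squnion>\<^bsub>N\<^esub> c \<in> carrier N"
      using N.join_closed c by blast+
    have "covers_eq L (h a \<squnion>\<^bsub>L\<^esub> h c) (h b \<squnion>\<^bsub>L\<^esub> h c)"
      using L(2)[unfolded semimodular_def, rule_format, OF hc[OF c(1)] hc[OF c(2)] hc[OF c(3)]]
        cov[OF c(1,2)] ab by simp
    then have "covers_eq L (h (a \<squnion>\<^bsub>N\<^esub> c)) (h (b \<squnion>\<^bsub>N\<^esub> c))"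
      using h_join[OF c(1,3)] h_join[OF c(2,3)] by simp
    then show "covers_eq N (a \<squnion>\<^bsub>N\<^esub> c) (b \<squnion>\<^bsub>N\<^esub> c)"
      unfolding covers_eq_def using cov[OF j] h_eq[OF j] by blast
  qed
  moreover have "realizer N (f \<circ> h) (g \<circ> h)"
    unfolding realizer_def
  proof (intro conjI ballI)
    have "inj_on f (carrier L)" "inj_on g (carrier L)" using L(3) unfolding realizer_def by blast+
    then show "inj_on (f \<circ> h) (carrier N)" "inj_on (g \<circ> h) (carrier N)"
      using comp_inj_on[OF h(2), unfolded h(1)] by blast+
    show "x \<sqsubseteq>\<^bsub>N\<^esub> y \<longleftrightarrow> (f \<circ> h) x \<le> (f \<circ> h) y \<and> (g \<circ> h) x \<le> (g \<circ> h) y"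
      if "x \<in> carrier N" "y \<in> carrier N" for x y
      using L(3) hc[OF that(1)] hc[OF that(2)] unfolding realizer_def N(2) by simp
  qed
  moreover have "order_isomorphic N L"
    unfolding order_isomorphic_def order_emb_def
    using bij N(2) N.weak_partial_order_axioms weak_partial_order_axioms by blast
  ultimately show thesis by (rule that)
qed

theorem theorem3:
  fixes L :: "'a gorder"
  assumes "planar_lattice L" and "semimodular L"
  shows "\<exists>m n X Y D (K :: nat gorder) \<phi> M pos (N :: nat gorder).
    (X = {} \<or> left_corner m n X) \<and> (Y = {} \<or> right_corner m n Y) \<and>
    D = restrict_to (grid m n) (carrier (grid m n) - X - Y) \<and>
    planar_lattice D \<and> distributive D \<and>
    finite_lattice K \<and> cover_preserving_join_hom D K \<phi> \<and>
    M = restrict_to K (\<phi> ` carrier D) \<and> planar_lattice M \<and>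
    planar_diagram M pos \<and> adds_to_four_cells M pos N \<and> order_isomorphic N L"
proof -
  have fin: "finite_lattice L" using assms(1) unfolding planar_lattice_def by blast
  obtain f g where "realizer L f g" using planar_lattice_realizer[OF assms(1)] by blast
  then obtain N :: "nat gorder" and f' g' where N: "finite_lattice N" "semimodular N" "realizer N f' g'"
    and iso: "order_isomorphic N L"
    using finite_lattice_nat_copy[OF fin assms(2)] by blast
  \<comment> \<open>The two empty differences are the empty corners \<open>X\<close> and
    \<open>Y\<close>.\<close>
  obtain m n D and K :: "nat gorder" and \<phi> M pos
    where "D = restrict_to (grid m n) (carrier (grid m n) - {} - {}) \<and>
      planar_lattice D \<and> distributive D \<and> finite_lattice K \<and> cover_preserving_join_hom D K \<phi> \<and>
      M = restrict_to K (\<phi> ` carrier D) \<and> planar_lattice M \<and> planar_diagram M pos \<and>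
      adds_to_four_cells M pos N"
    using realized_decomposition[OF N] by auto
  with iso show ?thesis by blast
qed

end
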